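(* Let $\mathcal{H}$ and $\mathcal{K}$ be finite-dimensional complex Hilbert spaces, both of dimension greater than $1$. Let $\mathcal{HP}$ be the set of all Hermitian-preserving trace-preserving linear maps $B(\mathcal{H})\to B(\mathcal{K})$, equipped with the topology induced by any norm (on the real vector space of Hermitian-preserving maps). Then: (1) The set $\mathcal{SP}$ of SP maps in $\mathcal{HP}$ is open and unbounded in $\mathcal{HP}$ but not convex; it is star-shaped, and its star center equals $\mathcal{SP}\cap\mathcal{P}$. (2) The set $\mathcal{SN}$ of SN maps in $\mathcal{HP}$ is closed and unbounded in $\mathcal{HP}$ but not convex; it is star-shaped, and its star center equals $\mathcal{P}$. (3) The set $\mathcal{SPR}$ of SPR maps in $\mathcal{HP}$ is unbounded, neither open nor closed in $\mathcal{HP}$, and not convex; it is star-shaped, and its star center equals $\mathcal{P}$. (4) The set $\mathcal{P}$ of positive maps in $\mathcal{HP}$ is compact and convex. (5) The set $\mathcal{CP}$ of completely positive maps in $\mathcal{HP}$ is compact and convex.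
   Context: $B(\mathcal{H})$ denotes all linear operators on $\mathcal{H}$; a density matrix is a positive semidefinite operator of trace one. A map is Hermitian-preserving if $\Psi(X^\dagger)=\Psi(X)^\dagger$ and trace-preserving if $\operatorname{Tr}\Psi(X)=\operatorname{Tr}X$. An HP map $\Psi$ is SP (semi-positive) if there is an invertible density matrix $\rho\in B(\mathcal{H})$ with $\Psi(\rho)$ an invertible density matrix in $B(\mathcal{K})$. Let $\mathcal{K}_\Psi=\operatorname{Span}\big(\bigcup_{a\in B(\mathcal{H})}\operatorname{Range}(\Psi(a))\big)$; regarding $\Psi$ as a map into $B(\mathcal{K}_\Psi)$ (each $\Psi(a)$ maps into $\mathcal{K}_\Psi$ and vanishes on $\mathcal{K}_\Psi^\perp$), $\Psi$ is SPR (semi-positive after reduction) if this map into $B(\mathcal{K}_\Psi)$ is SP. An HPTP map is SN (semi-nonnegative) if there is a density matrix $\rho$ with $\Psi(\rho)$ a density matrix. A set $M$ is star-shaped if there is a point $c\in M$ such that the segment $\{\lambda x+(1-\lambda)c:\lambda\in[0,1]\}$ lies in $M$ for every $x\in M$; the star center of $M$ is the set of all such points $c$. *)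

theory Defs
  imports "HOL-Analysis.Analysis"
begin

text \<open>Operators on H = C^'n are matrices complex^'n^'n.  A linear map
  Psi : B(H) -> B(K) is represented by its coefficient tensor
  C :: complex^'m^'m^'n^'n with C$i$j = Psi(E_ij) (image of the matrix unit).
  This is a linear bijection between linear maps and tensors; the Euclidean
  norm on the tensor space is a norm on the space of maps.\<close>

definition app :: "complex^'m^'m^'n^'n \<Rightarrow> complex^'n^'n \<Rightarrow> complex^'m^'m" where
  "app C X = (\<chi> k l. \<Sum>i\<in>UNIV. \<Sum>j\<in>UNIV. X$i$j * C$i$j$k$l)"

definition mtrace :: "complex^'n^'n \<Rightarrow> complex" where
  "mtrace A = (\<Sum>i\<in>UNIV. A$i$i)"

definition madj :: "complex^'n^'n \<Rightarrow> complex^'n^'n" where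
  "madj A = (\<chi> i j. cnj (A$j$i))"

definition qform :: "complex^'n^'n \<Rightarrow> complex^'n \<Rightarrow> complex" where
  "qform A v = (\<Sum>i\<in>UNIV. cnj (v$i) * (A *v v)$i)"

definition psd :: "complex^'n^'n \<Rightarrow> bool" where
  "psd A \<longleftrightarrow> (\<forall>v. Im (qform A v) = 0 \<and> Re (qform A v) \<ge> 0)"

definition density :: "complex^'n^'n \<Rightarrow> bool" where
  "density A \<longleftrightarrow> psd A \<and> mtrace A = 1"

definition herm_pres :: "complex^'m^'m^'n^'n \<Rightarrow> bool" where
  "herm_pres C \<longleftrightarrow> (\<forall>X. app C (madj X) = madj (app C X))"

definition trace_pres :: "complex^'m^'m^'n^'n \<Rightarrow> bool" where
  "trace_pres C \<longleftrightarrow> (\<forall>X. mtrace (app C X) = mtrace X)"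

definition HPTP :: "(complex^'m^'m^'n^'n) set" where
  "HPTP = {C. herm_pres C \<and> trace_pres C}"

definition SP_map :: "complex^'m^'m^'n^'n \<Rightarrow> bool" where
  "SP_map C \<longleftrightarrow> (\<exists>\<rho>. density \<rho> \<and> invertible \<rho> \<and>
      density (app C \<rho>) \<and> invertible (app C \<rho>))"

definition SN_map :: "complex^'m^'m^'n^'n \<Rightarrow> bool" where
  "SN_map C \<longleftrightarrow> (\<exists>\<rho>. density \<rho> \<and> density (app C \<rho>))"

definition out_space :: "complex^'m^'m^'n^'n \<Rightarrow> (complex^'m) set" where
  "out_space C = vec.span (\<Union>X. range (\<lambda>v. app C X *v v))"

text \<open>Psi(rho), regarded as an operator on K_Psi, is an invertible density matrix:
  positive semidefinite on K_Psi, trace one (the trace of the restriction equals the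
  trace of Psi(rho), which vanishes on the orthogonal complement of K_Psi), and
  bijective from K_Psi onto K_Psi.\<close>
definition SPR_map :: "complex^'m^'m^'n^'n \<Rightarrow> bool" where
  "SPR_map C \<longleftrightarrow> (\<exists>\<rho>. density \<rho> \<and> invertible \<rho> \<and>
      (\<forall>v\<in>out_space C. Im (qform (app C \<rho>) v) = 0 \<and> Re (qform (app C \<rho>) v) \<ge> 0) \<and>
      mtrace (app C \<rho>) = 1 \<and>
      bij_betw (\<lambda>v. app C \<rho> *v v) (out_space C) (out_space C))"

definition positive_map :: "complex^'m^'m^'n^'n \<Rightarrow> bool" where
  "positive_map C \<longleftrightarrow> (\<forall>X. psd X \<longrightarrow> psd (app C X))"

definition block_psd :: "nat \<Rightarrow> (nat \<Rightarrow> nat \<Rightarrow> complex^'n^'n) \<Rightarrow> bool" where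
  "block_psd k B \<longleftrightarrow> (\<forall>v :: nat \<Rightarrow> complex^'n.
     let q = (\<Sum>a<k. \<Sum>b<k. \<Sum>i\<in>UNIV. cnj (v a $ i) * (B a b *v v b) $ i)
     in Im q = 0 \<and> Re q \<ge> 0)"

definition cp_map :: "complex^'m^'m^'n^'n \<Rightarrow> bool" where
  "cp_map C \<longleftrightarrow> (\<forall>k B. block_psd k B \<longrightarrow> block_psd k (\<lambda>a b. app C (B a b)))"

definition SPs :: "(complex^'m^'m^'n^'n) set" where "SPs = {C \<in> HPTP. SP_map C}"
definition SNs :: "(complex^'m^'m^'n^'n) set" where "SNs = {C \<in> HPTP. SN_map C}"
definition SPRs :: "(complex^'m^'m^'n^'n) set" where "SPRs = {C \<in> HPTP. SPR_map C}"
definition Ps :: "(complex^'m^'m^'n^'n) set" where "Ps = {C \<in> HPTP. positive_map C}"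
definition CPs :: "(complex^'m^'m^'n^'n) set" where "CPs = {C \<in> HPTP. cp_map C}"

definition star_center :: "'a::real_vector set \<Rightarrow> 'a set" where
  "star_center S = {c \<in> S. \<forall>x\<in>S. closed_segment c x \<subseteq> S}"

end

theory Submission
  imports Defs
begin

text \<open>
  A Hermitian-preserving trace-preserving map is SPR iff some positive definite \<open>\<rho>\<close> of trace
  one has a positive semidefinite image whose kernel is annihilated by the whole range of the
  map. Every positive map has this property for every such \<open>\<rho>\<close>, because a Hermitian matrix is
  bounded by a multiple of \<open>\<rho>\<close>; hence \<open>P \<subseteq> SPR\<close> and \<open>SP \<subseteq> SPR \<subseteq> SN\<close>, and mixing with a
  positive map preserves each of the three properties.

  Conversely, let \<open>\<Psi>(\<rho>)\<close> fail to be positive semidefinite for a positive definite \<open>\<rho>\<close> of trace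
  one. Then \<open>\<Phi>(X) = tr(X) I/d - t (\<Psi>(X) - tr(X) \<Psi>(\<rho>))\<close> sends \<open>\<rho>\<close> to \<open>I/d\<close> and so is SP, while
  \<open>(t \<Psi> + \<Phi>)/(1 + t)\<close> is the constant map \<open>X \<mapsto> tr(X) (I/d + t \<Psi>(\<rho>))/(1 + t)\<close>, which is not even
  SN for large \<open>t\<close>. So each star center is contained in \<open>P\<close>. Since \<open>P\<close> is bounded and \<open>SP\<close> is
  not, none of the three sets can coincide with its star center, so none is convex.
\<close>

section \<open>Positive semidefinite matrices\<close>

text \<open>The Hermitian inner product, conjugate linear in the first argument;
  \<open>inner\<close> on \<open>complex^'n\<close> is only its real part.\<close>

definition hip :: "complex^'n \<Rightarrow> complex^'n \<Rightarrow> complex" where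
  "hip v w = (\<Sum>i\<in>UNIV. cnj (v$i) * w$i)"

lemma hip_add_left: "hip (u + v) w = hip u w + hip v w"
  by (simp add: hip_def algebra_simps sum.distrib)

lemma hip_add_right: "hip u (v + w) = hip u v + hip u w"
  by (simp add: hip_def algebra_simps sum.distrib)

lemma hip_diff_right: "hip u (v - w) = hip u v - hip u w"
  by (simp add: hip_def algebra_simps sum_subtractf)

lemma hip_scale_left: "hip (c *s v) w = cnj c * hip v w"
  by (simp add: hip_def sum_distrib_left mult_ac)

lemma hip_scale_right: "hip v (c *s w) = c * hip v w"
  by (simp add: hip_def sum_distrib_left mult_ac)

lemma hip_zero_right [simp]: "hip v 0 = 0"
  by (simp add: hip_def)

lemma cnj_hip: "cnj (hip v w) = hip w v"
  by (simp add: hip_def mult.commute)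

lemma hip_self: "hip v v = of_real ((norm v)\<^sup>2)"
proof -
  have "(norm v)\<^sup>2 = (\<Sum>i\<in>UNIV. (norm (v$i))\<^sup>2)"
    by (simp add: norm_vec_def L2_set_def sum_nonneg)
  then show ?thesis
    by (simp add: hip_def complex_norm_square mult.commute del: of_real_power)
qed

lemma hip_adjoint: "hip v (A *v w) = hip (madj A *v v) w"
proof -
  have "hip v (A *v w) = (\<Sum>i\<in>UNIV. \<Sum>j\<in>UNIV. cnj (v$i) * (A$i$j * w$j))"
    by (simp add: hip_def matrix_vector_mult_def sum_distrib_left)
  also have "\<dots> = (\<Sum>j\<in>UNIV. \<Sum>i\<in>UNIV. cnj (v$i) * (A$i$j * w$j))"
    by (rule sum.swap)
  also have "\<dots> = hip (madj A *v v) w"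
    by (simp add: hip_def matrix_vector_mult_def madj_def sum_distrib_left sum_distrib_right mult_ac)
  finally show ?thesis .
qed

lemma qform_hip: "qform A v = hip v (A *v v)"
  by (simp add: qform_def hip_def)

text \<open>A termwise estimate; the dimension factor lost against Cauchy-Schwarz is harmless, since
  only some finite bound on \<open>qform\<close> matters.\<close>

lemma norm_hip_le: "cmod (hip v w) \<le> real CARD('n) * (norm v * norm w)"
  for v w :: "complex^'n"
proof -
  have "cmod (hip v w) \<le> (\<Sum>i\<in>(UNIV::'n set). norm v * norm w)"
    unfolding hip_def
    by (rule order_trans[OF norm_sum], rule sum_mono)
       (simp add: norm_mult mult_mono Finite_Cartesian_Product.norm_nth_le)
  then show ?thesis by simp
qed

lemma norm_vec_le_sum: "norm x \<le> (\<Sum>i\<in>UNIV. norm (x$i))"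
  unfolding norm_vec_def by (rule L2_set_le_sum) simp

lemma norm_matrix_vector_le: "norm (A *v v) \<le> (real CARD('n))\<^sup>2 * (norm A * norm v)"
  for A :: "complex^'n^'n"
proof -
  have "norm (A$i$j) \<le> norm A" for i j
    by (rule order_trans[OF Finite_Cartesian_Product.norm_nth_le Finite_Cartesian_Product.norm_nth_le])
  then have *: "norm (A$i$j * v$j) \<le> norm A * norm v" for i j
    by (simp add: norm_mult mult_mono Finite_Cartesian_Product.norm_nth_le)
  have "norm (A *v v) \<le> (\<Sum>i\<in>UNIV. norm ((A *v v)$i))"
    by (rule norm_vec_le_sum)
  also have "\<dots> \<le> (\<Sum>i\<in>(UNIV::'n set). \<Sum>j\<in>(UNIV::'n set). norm A * norm v)"
    unfolding matrix_vector_mult_def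
    by (rule sum_mono, simp only: vec_lambda_beta, rule order_trans[OF norm_sum], rule sum_mono)
       (rule *)
  finally show ?thesis by (simp add: power2_eq_square algebra_simps)
qed

lemma qform_bound:
  "cmod (qform A v) \<le> (real CARD('n))^3 * norm A * (norm v)\<^sup>2" for A :: "complex^'n^'n"
proof -
  have "cmod (qform A v) \<le> real CARD('n) * (norm v * norm (A *v v))"
    unfolding qform_hip by (rule norm_hip_le)
  also have "\<dots> \<le> real CARD('n) * (norm v * ((real CARD('n))\<^sup>2 * (norm A * norm v)))"
    by (intro mult_left_mono norm_matrix_vector_le) auto
  finally show ?thesis by (simp add: power2_eq_square power3_eq_cube mult_ac)
qed

section \<open>Algebra of quadratic forms, adjoints and traces\<close>

lemma qform_add: "qform (A + B) v = qform A v + qform B v"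
  by (simp add: qform_hip matrix_vector_mult_add_rdistrib hip_add_right)

lemma qform_diff: "qform (A - B) v = qform A v - qform B v"
  by (simp add: qform_hip matrix_vector_mult_diff_rdistrib hip_diff_right)

lemma scaleR_mult_vec: "(r *\<^sub>R A) *v v = of_real r *s (A *v v)" for A :: "complex^'n^'n"
  by (simp add: vec_eq_iff matrix_vector_mult_def sum_distrib_left
      scaleR_conv_of_real[where 'a=complex] mult_ac)

lemma qform_scaleR: "qform (r *\<^sub>R A) v = of_real r * qform A v"
  by (simp add: qform_hip scaleR_mult_vec hip_scale_right)

lemma qform_sum_vec:
  "qform A (v + w) = qform A v + hip v (A *v w) + hip w (A *v v) + qform A w"
  by (simp add: qform_hip matrix_vector_right_distrib hip_add_left hip_add_right)

lemma qform_scale_vec: "qform A (c *s v) = of_real ((cmod c)\<^sup>2) * qform A v"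
  by (simp add: qform_hip vector_scalar_commute hip_scale_left hip_scale_right
      complex_norm_square mult_ac del: of_real_power)

lemma qform_madj: "qform (madj A) v = cnj (qform A v)"
  by (simp add: qform_hip hip_adjoint cnj_hip)

lemma qform_zero_vec [simp]: "qform A 0 = 0"
  by (simp add: qform_hip)

lemma madj_madj [simp]: "madj (madj A) = A"
  by (simp add: madj_def vec_eq_iff)

lemma madj_add: "madj (A + B) = madj A + madj B"
  by (simp add: madj_def vec_eq_iff)

lemma madj_diff: "madj (A - B) = madj A - madj B"
  by (simp add: madj_def vec_eq_iff)

lemma madj_minus: "madj (- A) = - madj A"
  by (simp add: madj_def vec_eq_iff)

lemma madj_scaleR: "madj (r *\<^sub>R A) = r *\<^sub>R madj A"
  by (simp add: madj_def vec_eq_iff)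

lemma mtrace_add: "mtrace (A + B) = mtrace A + mtrace B"
  by (simp add: mtrace_def sum.distrib)

lemma mtrace_diff: "mtrace (A - B) = mtrace A - mtrace B"
  by (simp add: mtrace_def sum_subtractf)

lemma mtrace_scaleR: "mtrace (r *\<^sub>R A) = of_real r * mtrace A"
  by (simp add: mtrace_def sum_distrib_left scaleR_conv_of_real[where 'a=complex])

lemma matrix_vector_mult_axis: "(A *v axis l 1) $ k = A$k$l" for A :: "complex^'n^'m"
proof -
  have "(A *v axis l 1) $ k = (\<Sum>j\<in>UNIV. if j = l then A$k$j else 0)"
    unfolding matrix_vector_mult_def vec_lambda_beta by (rule sum.cong) (auto simp: axis_def)
  then show ?thesis by simp
qed

lemma hip_axis: "hip (axis k 1) (A *v axis l 1) = A$k$l"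
proof -
  have "hip (axis k 1) (A *v axis l 1) = (\<Sum>i\<in>UNIV. if i = k then A$i$l else 0)"
    unfolding hip_def matrix_vector_mult_axis by (rule sum.cong) (auto simp: axis_def)
  then show ?thesis by simp
qed

lemma qform_axis: "qform A (axis k 1) = A$k$k"
  by (simp add: qform_hip hip_axis)

text \<open>Polarization: expanding the form at \<open>v + w\<close> and at
  \<open>v + \<i> *s w\<close> shows that the sum and the difference of the two cross terms vanish,
  hence each of them.\<close>

lemma matrix_eq_zero_if_qform_zero:
  assumes "\<And>v. qform A v = 0"
  shows "A = 0"
proof -
  have "hip v (A *v w) = 0" for v w
  proof -
    have 1: "hip v (A *v w) + hip w (A *v v) = 0"
      using qform_sum_vec[of A v w] by (simp add: assms)
    have 2: "\<i> * hip v (A *v w) - \<i> * hip w (A *v v) = 0"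
      using qform_sum_vec[of A v "\<i> *s w"]
      by (simp add: assms vector_scalar_commute hip_scale_left hip_scale_right)
    then have "hip v (A *v w) = hip w (A *v v)" by simp
    with 1 show ?thesis by simp
  qed
  from this[of "axis _ 1" "axis _ 1"] show ?thesis
    by (simp add: hip_axis vec_eq_iff)
qed

text \<open>The form of \<open>madj A - A\<close> is the conjugate of that of \<open>A\<close> minus
  itself, so it vanishes for real values and polarization applies.\<close>

lemma hermitian_iff_qform_real: "madj A = A \<longleftrightarrow> (\<forall>v. Im (qform A v) = 0)"
proof
  assume "madj A = A"
  then show "\<forall>v. Im (qform A v) = 0"
    using qform_madj[of A] by (metis Reals_cnj_iff complex_is_Real_iff)
next
  assume "\<forall>v. Im (qform A v) = 0"
  then have "qform (madj A - A) v = 0" for v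
    by (simp add: qform_diff qform_madj complex_eq_iff)
  then show "madj A = A" using matrix_eq_zero_if_qform_zero by fastforce
qed

lemma psd_hermitian: "psd A \<Longrightarrow> madj A = A"
  by (simp add: hermitian_iff_qform_real psd_def)

lemma psd_iff: "psd A \<longleftrightarrow> madj A = A \<and> (\<forall>v. Re (qform A v) \<ge> 0)"
  by (auto simp: psd_def hermitian_iff_qform_real)

lemma psd_add: "psd A \<Longrightarrow> psd B \<Longrightarrow> psd (A + B)"
  by (simp add: psd_def qform_add)

lemma psd_scaleR: "psd A \<Longrightarrow> 0 \<le> r \<Longrightarrow> psd (r *\<^sub>R A)"
  by (simp add: psd_def qform_scaleR)

lemma psd_diag_nonneg: "psd A \<Longrightarrow> Re (A$k$k) \<ge> 0"
  by (metis psd_def qform_axis)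

text \<open>Move from \<open>v\<close> in the direction \<open>w = A *v v\<close>: the form becomes
  a quadratic in \<open>t\<close> without constant term, and its linear term would make it negative
  for small negative \<open>t\<close> unless \<open>w = 0\<close>.\<close>

lemma psd_qform_zero_kernel:
  assumes "psd A" and "Re (qform A v) = 0"
  shows "A *v v = 0"
proof (rule ccontr)
  assume nz: "A *v v \<noteq> 0"
  define w where "w = A *v v"
  define q where "q = Re (qform A w)"
  have q: "q \<ge> 0" using assms(1) by (simp add: q_def psd_def)
  have n: "(norm w)\<^sup>2 > 0" using nz by (simp add: w_def)
  have 1: "hip w (A *v v) = of_real ((norm w)\<^sup>2)"
    using hip_self[of w] by (simp add: w_def)
  have 2: "hip v (A *v w) = of_real ((norm w)\<^sup>2)"
    using hip_self[of w] psd_hermitian[OF assms(1)] by (simp add: w_def hip_adjoint)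
  have ineq: "2 * t * (norm w)\<^sup>2 + t\<^sup>2 * q \<ge> 0" for t
  proof -
    have "0 \<le> Re (qform A (v + of_real t *s w))"
      using assms(1) by (simp add: psd_def)
    also have "\<dots> = 2 * t * (norm w)\<^sup>2 + t\<^sup>2 * q"
      using 1 2 assms(2)
      by (simp add: qform_sum_vec qform_scale_vec vector_scalar_commute hip_scale_left
          hip_scale_right q_def algebra_simps del: of_real_power)
    finally show ?thesis .
  qed
  \<comment> \<open>Makes \<open>(norm w)\<^sup>2 = t * (q + 1)\<close>, so the quadratic is
    negative at \<open>- t\<close>; the \<open>+ 1\<close> avoids division by zero when
    \<open>q = 0\<close>.\<close>
  define t where "t = (norm w)\<^sup>2 / (q + 1)"
  have t: "t > 0" using n q by (simp add: t_def)
  have tq: "(norm w)\<^sup>2 = t * (q + 1)" using q by (simp add: t_def)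
  have "2 * (- t) * (norm w)\<^sup>2 + (-t)\<^sup>2 * q = - (t * (t * q + 2 * t))"
    unfolding tq by (simp add: power2_eq_square algebra_simps)
  also have "\<dots> < 0" using t q by (simp add: mult_pos_pos add_nonneg_pos)
  finally show False using ineq[of "-t"] by simp
qed

text \<open>Every entry is bounded by the trace: the diagonal ones are nonnegative summands of it,
  and the form at \<open>axis k 1 + z *s axis l 1\<close> with a suitable phase \<open>z\<close>
  bounds twice the modulus of an off-diagonal entry by the sum of two diagonal ones.\<close>

lemma psd_norm_le_trace:
  fixes A :: "complex^'n^'n"
  assumes "psd A"
  shows "norm A \<le> (real CARD('n))\<^sup>2 * Re (mtrace A)"
proof -
  have diag: "Re (A$k$k) \<le> Re (mtrace A)" for k
    unfolding mtrace_def Re_sum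
    by (rule member_le_sum) (auto intro: psd_diag_nonneg[OF assms])
  have entry: "cmod (A$k$l) \<le> Re (mtrace A)" for k l
  proof -
    \<comment> \<open>The phase that turns the entry into minus its modulus; it is \<open>0\<close>
      when the entry is, so only \<open>cmod z \<le> 1\<close> is claimed.\<close>
    define z where "z = - cnj (sgn (A$k$l))"
    have za: "z * A$k$l = - of_real (cmod (A$k$l))"
    proof (cases "A$k$l = 0")
      case False
      have "cnj (sgn (A$k$l)) * A$k$l = of_real (cmod (A$k$l))"
        using False complex_norm_square[of "A$k$l"]
        by (simp add: sgn_eq field_simps power2_eq_square)
      then show ?thesis by (simp add: z_def)
    qed simp
    have lk: "A$l$k = cnj (A$k$l)"
      using psd_hermitian[OF assms] unfolding madj_def vec_eq_iff by (metis vec_lambda_beta)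
    have nz: "(cmod z)\<^sup>2 \<le> 1"
      by (simp add: z_def norm_sgn power_le_one)
    have "0 \<le> Re (qform A (axis k 1 + z *s axis l 1))"
      using assms by (simp add: psd_def)
    also have "\<dots> = Re (A$k$k) + Re (z * A$k$l) + Re (cnj z * A$l$k) + (cmod z)\<^sup>2 * Re (A$l$l)"
      by (simp only: qform_sum_vec qform_scale_vec vector_scalar_commute hip_scale_left
          hip_scale_right qform_axis hip_axis) simp
    also have "Re (cnj z * A$l$k) = Re (z * A$k$l)"
      by (simp add: lk)
    also have "Re (z * A$k$l) = - cmod (A$k$l)"
      by (simp add: za)
    also have "(cmod z)\<^sup>2 * Re (A$l$l) \<le> Re (A$l$l)"
      using nz psd_diag_nonneg[OF assms, of l] by (simp add: mult_left_le_one_le)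
    finally show ?thesis using diag[of k] diag[of l] by simp
  qed
  have "norm A \<le> (\<Sum>k\<in>UNIV. norm (A$k))" by (rule norm_vec_le_sum)
  also have "\<dots> \<le> (\<Sum>k\<in>UNIV. \<Sum>l\<in>UNIV. norm (A$k$l))"
    by (intro sum_mono norm_vec_le_sum)
  also have "\<dots> \<le> (\<Sum>k\<in>(UNIV::'n set). \<Sum>l\<in>(UNIV::'n set). Re (mtrace A))"
    by (intro sum_mono entry)
  finally show ?thesis by (simp add: power2_eq_square algebra_simps)
qed

section \<open>Positive definite matrices\<close>

definition pdef :: "complex^'n^'n \<Rightarrow> bool" where
  "pdef A \<longleftrightarrow> madj A = A \<and> (\<forall>v. v \<noteq> 0 \<longrightarrow> Re (qform A v) > 0)"

lemma pdef_psd: "pdef A \<Longrightarrow> psd A"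
  unfolding pdef_def psd_iff by (metis less_eq_real_def qform_zero_vec zero_complex.sel(1))

text \<open>A kernel vector has form zero, and the converse for \<open>psd\<close> is
  \<open>psd_qform_zero_kernel\<close>. This turns the invertible density matrices of the
  definitions into \<open>pdef\<close> matrices of trace one.\<close>

lemma pdef_iff: "pdef A \<longleftrightarrow> psd A \<and> invertible A"
proof
  assume A: "pdef A"
  have "x = 0" if "A *v x = 0" for x
    using A that unfolding pdef_def qform_hip by force
  then show "psd A \<and> invertible A"
    using A by (auto simp: pdef_psd invertible_left_inverse matrix_left_invertible_ker)
next
  assume A: "psd A \<and> invertible A"
  then have "x = 0" if "A *v x = 0" for x
    using that unfolding invertible_left_inverse matrix_left_invertible_ker by blast
  then have "Re (qform A v) \<noteq> 0" if "v \<noteq> 0" for v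
    using psd_qform_zero_kernel A that by blast
  then show "pdef A"
    using A unfolding psd_iff pdef_def by (auto simp: less_le)
qed

lemma pdef_add_psd: "pdef A \<Longrightarrow> psd B \<Longrightarrow> pdef (A + B)"
  by (auto simp: pdef_def psd_iff madj_add qform_add add_pos_nonneg)

lemma pdef_scaleR: "pdef A \<Longrightarrow> 0 < r \<Longrightarrow> pdef (r *\<^sub>R A)"
  by (auto simp: pdef_def madj_scaleR qform_scaleR)

lemma continuous_on_qform: "continuous_on S (\<lambda>v. qform A v)"
  unfolding qform_def matrix_vector_mult_def vec_lambda_beta
  by (intro continuous_on_sum continuous_on_mult continuous_on_cnj
      bounded_linear.continuous_on[OF bounded_linear_vec_nth]
      continuous_on_const continuous_on_id)

text \<open>The form attains a positive minimum on the compact unit sphere and scales with the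
  square of the norm.\<close>

lemma pdef_lower_bound:
  assumes "pdef A"
  obtains m where "m > 0" and "\<And>v. Re (qform A v) \<ge> m * (norm v)\<^sup>2"
proof -
  have "\<exists>x\<in>sphere 0 1. \<forall>y\<in>sphere 0 1. Re (qform A x) \<le> Re (qform A y)"
  proof (rule continuous_attains_inf)
    show "sphere (0::complex^'a) 1 \<noteq> {}"
      by simp
    show "continuous_on (sphere 0 1) (\<lambda>x. Re (qform A x))"
      by (intro continuous_on_Re continuous_on_qform)
  qed simp
  then obtain x where x: "norm x = 1" "\<And>y. norm y = 1 \<Longrightarrow> Re (qform A x) \<le> Re (qform A y)"
    by auto
  define m where "m = Re (qform A x)"
  have "x \<noteq> 0" using x(1) by auto
  then have "m > 0" using assms by (simp add: m_def pdef_def)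
  moreover have "Re (qform A v) \<ge> m * (norm v)\<^sup>2" for v
  proof (cases "v = 0")
    case False
    define u where "u = of_real (1 / norm v) *s v"
    have v: "of_real (norm v) *s u = v" using False by (simp add: u_def vec_eq_iff)
    have "u = (1 / norm v) *\<^sub>R v"
      by (simp add: u_def vec_eq_iff scaleR_conv_of_real[where 'a=complex])
    then have "norm u = 1" using False by simp
    then have "m \<le> Re (qform A u)" using x(2) by (simp add: m_def)
    moreover have "Re (qform A v) = (norm v)\<^sup>2 * Re (qform A u)"
      using qform_scale_vec[of A "of_real (norm v)" u] by (simp add: v del: of_real_power)
    ultimately show ?thesis by (simp add: mult.commute mult_right_mono)
  qed simp
  ultimately show thesis using that by blast
qed

text \<open>Positive definiteness is open among Hermitian matrices: below norm \<open>m / K\<close>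
  a perturbation changes the form by less than its lower bound
  \<open>m * (norm v)\<^sup>2\<close>.\<close>

lemma pdef_absorbs_small:
  assumes "pdef A"
  obtains e where "e > 0" and "\<And>B. madj B = B \<Longrightarrow> norm B < e \<Longrightarrow> pdef (A + B)"
proof -
  obtain m where m: "m > 0" "\<And>v. Re (qform A v) \<ge> m * (norm v)\<^sup>2"
    using pdef_lower_bound[OF assms] by blast
  define K where "K = (real CARD('a))^3"
  have K: "K > 0" by (simp add: K_def)
  have "pdef (A + B)" if B: "madj B = B" "norm B < m / K" for B
    unfolding pdef_def
  proof (intro conjI allI impI)
    show "madj (A + B) = A + B" using assms B by (simp add: madj_add pdef_def)
    fix v :: "complex^'a" assume v: "v \<noteq> 0"
    have "\<bar>Re (qform B v)\<bar> \<le> K * norm B * (norm v)\<^sup>2"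
      unfolding K_def using abs_Re_le_cmod qform_bound order_trans by blast
    also have "\<dots> < m * (norm v)\<^sup>2"
      using B(2) K v by (simp add: field_simps)
    finally show "Re (qform (A + B) v) > 0" using m(2)[of v] by (simp add: qform_add)
  qed
  then show thesis using that[of "m / K"] m K by simp
qed

text \<open>Shrink \<open>B\<close> until \<open>A\<close> absorbs both signs of it, then scale
  back: a positive definite matrix is an order unit for the Hermitian ones.\<close>

lemma pdef_dominates_hermitian:
  assumes "pdef A" and "madj B = B"
  obtains c where "c > 0" and "psd (c *\<^sub>R A + B)" and "psd (c *\<^sub>R A - B)"
proof -
  obtain e where e: "e > 0" "\<And>B. madj B = B \<Longrightarrow> norm B < e \<Longrightarrow> pdef (A + B)"
    using pdef_absorbs_small[OF assms(1)] by blast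
  \<comment> \<open>The \<open>+ 1\<close> keeps \<open>c\<close> positive for \<open>B = 0\<close>
    and makes \<open>norm B < e * c\<close> strict.\<close>
  define c where "c = (norm B + 1) / e"
  have c: "c > 0" using e by (simp add: c_def add_nonneg_pos)
  have "c * e = norm B + 1" using e(1) by (simp add: c_def)
  then have "norm B < e * c" by (simp add: mult.commute)
  then have n: "norm ((1/c) *\<^sub>R B) < e"
    using c by (simp add: pos_divide_less_eq)
  have "pdef (A + (1/c) *\<^sub>R B)"
    using n assms(2) by (intro e(2)) (simp_all add: madj_scaleR)
  moreover have "pdef (A + (-1/c) *\<^sub>R B)"
    using n assms(2) by (intro e(2)) (simp_all add: madj_scaleR madj_minus)
  ultimately have "psd (c *\<^sub>R (A + (1/c) *\<^sub>R B))" "psd (c *\<^sub>R (A + (-1/c) *\<^sub>R B))"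
    using c by (simp_all only: psd_scaleR pdef_psd less_imp_le)
  then show thesis using that[of c] c by (simp add: scaleR_add_right scaleR_diff_right)
qed

text \<open>The maximally mixed state \<open>I/d\<close>, the witness in most examples.\<close>

definition mix_state :: "complex^'n^'n" where
  "mix_state = (1 / real CARD('n)) *\<^sub>R mat 1"

lemma madj_mat_1 [simp]: "madj (mat 1) = mat 1"
  by (auto simp: madj_def mat_def vec_eq_iff)

lemma pdef_mat_1: "pdef (mat 1)"
  by (auto simp: pdef_def qform_hip hip_self)

lemma pdef_mix_state: "pdef mix_state"
  unfolding mix_state_def by (intro pdef_scaleR pdef_mat_1) simp

lemma mtrace_mix_state [simp]: "mtrace mix_state = 1"
  by (simp add: mix_state_def mtrace_scaleR) (simp add: mtrace_def mat_def)

lemma SP_map_iff: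
  "SP_map C \<longleftrightarrow> (\<exists>\<rho>. pdef \<rho> \<and> mtrace \<rho> = 1 \<and> pdef (app C \<rho>) \<and> mtrace (app C \<rho>) = 1)"
  by (auto simp: SP_map_def density_def pdef_iff)

section \<open>Linear maps given by tensors\<close>

definition cscale :: "complex \<Rightarrow> complex^'n^'m \<Rightarrow> complex^'n^'m" where
  "cscale c A = (\<chi> i j. c * A$i$j)"

lemma cscale_1 [simp]: "cscale 1 A = A" and cscale_0 [simp]: "cscale 0 A = 0"
  by (simp_all add: cscale_def vec_eq_iff)

lemma cscale_of_real: "cscale (of_real r) A = r *\<^sub>R A"
  by (simp add: cscale_def vec_eq_iff scaleR_conv_of_real[where 'a=complex])

lemma madj_cscale: "madj (cscale c A) = cscale (cnj c) (madj A)"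
  by (simp add: cscale_def madj_def vec_eq_iff)

lemma mtrace_cscale: "mtrace (cscale c A) = c * mtrace A"
  by (simp add: cscale_def mtrace_def sum_distrib_left)

lemma cscale_mult_vec: "cscale c A *v v = c *s (A *v v)"
  by (simp add: cscale_def matrix_vector_mult_def vec_eq_iff sum_distrib_left mult_ac)

lemma norm_cscale_i_le: "norm (cscale \<i> A) \<le> norm A"
  by (intro norm_le_componentwise_cart) (simp add: cscale_def norm_mult)

text \<open>The Cartesian decomposition; by complex linearity of \<open>app\<close>, claims about
  arbitrary inputs reduce to Hermitian ones.\<close>

lemma hermitian_decomposition:
  obtains H K where "madj H = H" and "madj K = K" and "X = H + cscale \<i> K"
proof
  show "madj ((1/2) *\<^sub>R (X + madj X)) = (1/2) *\<^sub>R (X + madj X)"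
    by (simp add: madj_scaleR madj_add add.commute)
  show "madj (cscale (-\<i>/2) (X - madj X)) = cscale (-\<i>/2) (X - madj X)"
    by (simp add: madj_cscale madj_diff) (simp add: cscale_def vec_eq_iff algebra_simps)
  show "X = (1/2) *\<^sub>R (X + madj X) + cscale \<i> (cscale (-\<i>/2) (X - madj X))"
    by (simp add: cscale_def vec_eq_iff scaleR_conv_of_real[where 'a=complex] field_simps)
qed

lemma app_add: "app C (X + Y) = app C X + app C Y"
  by (simp add: app_def vec_eq_iff algebra_simps sum.distrib)

lemma app_diff: "app C (X - Y) = app C X - app C Y"
  by (simp add: app_def vec_eq_iff algebra_simps sum_subtractf)

lemma app_cscale: "app C (cscale c X) = cscale c (app C X)"
  by (simp add: app_def cscale_def vec_eq_iff sum_distrib_left mult_ac)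

lemma app_scaleR: "app C (r *\<^sub>R X) = r *\<^sub>R app C X"
  using app_cscale[of C "of_real r" X] by (simp add: cscale_of_real)

lemma app_add_map: "app (C + D) X = app C X + app D X"
  by (simp add: app_def vec_eq_iff algebra_simps sum.distrib)

lemma app_diff_map: "app (C - D) X = app C X - app D X"
  by (simp add: app_def vec_eq_iff algebra_simps sum_subtractf)

lemma app_scaleR_map: "app (r *\<^sub>R C) X = r *\<^sub>R app C X"
  by (simp add: app_def vec_eq_iff scaleR_conv_of_real[where 'a=complex] sum_distrib_left mult_ac)

lemmas app_map_simps = app_add_map app_diff_map app_scaleR_map

text \<open>A map of rank at most one: a weighted sum of the diagonal entries of the input, times
  the fixed output \<open>W\<close>. Weights constantly \<open>1\<close> give the trace.\<close>

definition diag_map :: "('n \<Rightarrow> real) \<Rightarrow> complex^'m^'m \<Rightarrow> complex^'m^'m^'n^'n" where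
  "diag_map g W = (\<chi> i j. if i = j then g i *\<^sub>R W else 0)"

definition const_map :: "complex^'m^'m \<Rightarrow> complex^'m^'m^'n^'n" where
  "const_map W = diag_map (\<lambda>_. 1) W"

lemma app_diag_map: "app (diag_map g W) X = cscale (\<Sum>i\<in>UNIV. of_real (g i) * X$i$i) W"
proof -
  have "(\<Sum>j\<in>UNIV. X$i$j * diag_map g W$i$j$k$l) = of_real (g i) * X$i$i * W$k$l" for i k l
  proof -
    have "(\<Sum>j\<in>UNIV. X$i$j * diag_map g W$i$j$k$l)
        = (\<Sum>j\<in>UNIV. if j = i then X$i$j * (g i *\<^sub>R W$k$l) else 0)"
      by (rule sum.cong) (auto simp: diag_map_def)
    then show ?thesis by (simp add: scaleR_conv_of_real)
  qed
  then show ?thesis by (simp add: app_def cscale_def vec_eq_iff sum_distrib_right)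
qed

lemma app_const_map: "app (const_map W) X = cscale (mtrace X) W"
  by (simp add: const_map_def app_diag_map mtrace_def)

lemma herm_pres_diag_map: "madj W = W \<Longrightarrow> herm_pres (diag_map g W)"
  unfolding herm_pres_def app_diag_map madj_cscale by (simp add: madj_def)

lemma herm_pres_add: "herm_pres C \<Longrightarrow> herm_pres D \<Longrightarrow> herm_pres (C + D)"
  by (simp add: herm_pres_def app_map_simps madj_add)

lemma herm_pres_diff: "herm_pres C \<Longrightarrow> herm_pres D \<Longrightarrow> herm_pres (C - D)"
  by (simp add: herm_pres_def app_map_simps madj_diff)

lemma herm_pres_scaleR: "herm_pres C \<Longrightarrow> herm_pres (r *\<^sub>R C)"
  by (simp add: herm_pres_def app_map_simps madj_scaleR)

lemma HPTP_hermitian: "C \<in> HPTP \<Longrightarrow> madj X = X \<Longrightarrow> madj (app C X) = app C X"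
  using herm_pres_def[of C] by (auto simp: HPTP_def dest: spec[of _ X])

lemma HPTP_mtrace: "C \<in> HPTP \<Longrightarrow> mtrace (app C X) = mtrace X"
  by (simp add: HPTP_def trace_pres_def)

lemma HPTP_affine: "C \<in> HPTP \<Longrightarrow> D \<in> HPTP \<Longrightarrow> a + b = 1 \<Longrightarrow> a *\<^sub>R C + b *\<^sub>R D \<in> HPTP"
  by (simp add: HPTP_def herm_pres_add herm_pres_scaleR trace_pres_def app_map_simps
      mtrace_add mtrace_scaleR flip: distrib_right of_real_add)

lemma HPTP_segment:
  assumes "C \<in> HPTP" "D \<in> HPTP" shows "(1 - u) *\<^sub>R C + u *\<^sub>R D \<in> HPTP"
  using assms by (intro HPTP_affine) auto

text \<open>The added term has trace zero on every input, whatever \<open>g\<close> and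
  \<open>r\<close> are; this supplies the directions in which the examples move.\<close>

lemma HPTP_add_traceless:
  assumes "C \<in> HPTP" "madj W = W" "mtrace W = 0"
  shows "C + r *\<^sub>R diag_map g W \<in> HPTP"
  using assms by (simp add: HPTP_def trace_pres_def herm_pres_add herm_pres_scaleR
      herm_pres_diag_map app_map_simps app_diag_map mtrace_add mtrace_scaleR mtrace_cscale)

lemma const_map_HPTP: "madj W = W \<Longrightarrow> mtrace W = 1 \<Longrightarrow> const_map W \<in> HPTP"
  using herm_pres_diag_map[of W "\<lambda>_. 1"]
  by (simp add: HPTP_def trace_pres_def app_const_map mtrace_cscale flip: const_map_def)

lemma psd_mtrace:
  assumes "psd A" shows "mtrace A = of_real (Re (mtrace A))" and "Re (mtrace A) \<ge> 0"
proof -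
  have "Im (A$k$k) = 0" "Re (A$k$k) \<ge> 0" for k
    using assms unfolding psd_def by (metis qform_axis)+
  then show "mtrace A = of_real (Re (mtrace A))" "Re (mtrace A) \<ge> 0"
    by (simp_all add: mtrace_def complex_eq_iff sum_nonneg)
qed

lemma pdef_mtrace_pos: "pdef A \<Longrightarrow> Re (mtrace A) > 0" for A :: "complex^'n^'n"
proof -
  assume "pdef A"
  moreover have "axis k (1::complex) \<noteq> 0" for k :: 'n by (simp add: axis_eq_0_iff)
  ultimately have "Re (A$k$k) > 0" for k
    unfolding pdef_def by (metis qform_axis)
  then show ?thesis by (simp add: mtrace_def sum_pos)
qed

lemma const_map_Ps:
  assumes "psd W" "mtrace W = 1" shows "(const_map W :: complex^'m^'m^'n^'n) \<in> Ps"
proof -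
  have "psd (app (const_map W) X)" if "psd X" for X :: "complex^'n^'n"
    using psd_mtrace[OF that] assms(1) psd_scaleR
    unfolding app_const_map by (metis cscale_of_real)
  then show ?thesis
    using assms by (simp add: Ps_def positive_map_def const_map_HPTP psd_hermitian)
qed

section \<open>Relations between the classes of maps\<close>

text \<open>For Hermitian \<open>H\<close> both \<open>c *\<^sub>R \<rho> + H\<close> and
  \<open>c *\<^sub>R \<rho> - H\<close> are positive semidefinite for some \<open>c\<close>. The
  forms of their images at \<open>v\<close> are nonnegative with sum zero, so both images annihilate
  \<open>v\<close>. Hence the kernel of \<open>app C \<rho>\<close> is the common kernel of all
  outputs.\<close>

lemma Ps_kernel:
  assumes C: "C \<in> Ps" and \<rho>: "pdef \<rho>" and v: "app C \<rho> *v v = 0"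
  shows "app C X *v v = 0"
proof -
  have herm: "app C H *v v = 0" if H: "madj H = H" for H
  proof -
    obtain c where c: "c > 0" "psd (c *\<^sub>R \<rho> + H)" "psd (c *\<^sub>R \<rho> - H)"
      using pdef_dominates_hermitian[OF \<rho> H] by blast
    define A B where "A = app C (c *\<^sub>R \<rho> + H)" and "B = app C (c *\<^sub>R \<rho> - H)"
    have AB: "psd A" "psd B" using C c by (simp_all add: Ps_def positive_map_def A_def B_def)
    have "qform A v + qform B v = 0"
      using v by (simp add: A_def B_def app_add app_diff app_scaleR qform_add qform_diff
          qform_scaleR) (simp add: qform_hip)
    then have "Re (qform A v) + Re (qform B v) = 0" by (metis plus_complex.sel(1) zero_complex.sel(1))
    moreover have "Re (qform A v) \<ge> 0" "Re (qform B v) \<ge> 0" using AB by (simp_all add: psd_def)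
    ultimately have "Re (qform A v) = 0" by simp
    then have "A *v v = 0" using AB psd_qform_zero_kernel by blast
    then show ?thesis
      using v by (simp add: A_def app_add app_scaleR matrix_vector_mult_add_rdistrib scaleR_mult_vec)
  qed
  obtain H K where HK: "madj H = H" "madj K = K" "X = H + cscale \<i> K"
    using hermitian_decomposition by blast
  show ?thesis
    using herm[OF HK(1)] herm[OF HK(2)]
    by (simp add: HK(3) app_add app_cscale matrix_vector_mult_add_rdistrib cscale_mult_vec)
qed

lemma app_mult_in_out_space: "app C X *v v \<in> out_space C"
  unfolding out_space_def by (rule vec.span_base) blast

lemma subspace_out_space: "vec.subspace (out_space C)"
  unfolding out_space_def by (rule vec.subspace_span)

text \<open>The adjoint of \<open>app C X\<close> is \<open>app C (madj X)\<close>, again an output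
  of the map, so a common kernel vector is orthogonal to every range and to their span.\<close>

lemma hip_out_space_zero:
  assumes "\<And>X. app C X *v u = 0" and "C \<in> HPTP" and "y \<in> out_space C"
  shows "hip u y = 0"
proof -
  have "y \<in> vec.span (\<Union>X. range (\<lambda>v. app C X *v v))"
    using assms(3) by (simp add: out_space_def)
  then show ?thesis
  proof (rule vec.span_induct)
    show "vec.subspace {y. hip u y = 0}"
      by (simp add: vec.subspace_def hip_add_right hip_scale_right)
  next
    fix x assume "x \<in> (\<Union>X. range (\<lambda>v. app C X *v v))"
    then obtain X v where x: "x = app C X *v v" by blast
    have "madj (app C X) = app C (madj X)"
      using assms(2) by (simp add: HPTP_def herm_pres_def)
    then show "hip u x = 0"
      using assms(1)[of "madj X"] by (simp add: x hip_adjoint) (simp add: hip_def)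
  qed
qed

text \<open>Eliminates the reduced space: bijectivity on \<open>out_space C\<close> becomes a
  condition on the kernel of \<open>app C \<rho>\<close>, which is easy to check on mixtures and
  limits.\<close>

lemma SPR_map_iff:
  fixes C :: "complex^'m^'m^'n^'n"
  assumes C: "C \<in> HPTP"
  shows "SPR_map C \<longleftrightarrow> (\<exists>\<rho>. pdef \<rho> \<and> mtrace \<rho> = 1 \<and> psd (app C \<rho>) \<and>
    (\<forall>v. app C \<rho> *v v = 0 \<longrightarrow> (\<forall>X. app C X *v v = 0)))"
proof
  assume "SPR_map C"
  then obtain \<rho> where \<rho>: "pdef \<rho>" "mtrace \<rho> = 1"
    and q: "\<And>v. v \<in> out_space C \<Longrightarrow> Re (qform (app C \<rho>) v) \<ge> 0"
    and bij: "bij_betw (\<lambda>v. app C \<rho> *v v) (out_space C) (out_space C)"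
    unfolding SPR_map_def density_def pdef_iff by blast
  define A where "A = app C \<rho>"
  have A: "madj A = A"
    unfolding A_def by (rule HPTP_hermitian[OF C psd_hermitian[OF pdef_psd[OF \<rho>(1)]]])
  have pre: "\<exists>w\<in>out_space C. y = A *v w" if "y \<in> out_space C" for y
    using bij that unfolding bij_betw_def A_def by blast
  \<comment> \<open>\<open>A\<close> maps \<open>out_space C\<close> onto itself, so
    \<open>A *v v = A *v w\<close> for some \<open>w\<close> in that space; as \<open>A\<close> is
    Hermitian, the forms at \<open>v\<close> and \<open>w\<close> agree.\<close>
  have "Re (qform A v) \<ge> 0" for v
  proof -
    obtain w where w: "w \<in> out_space C" "A *v v = A *v w"
      using pre[OF app_mult_in_out_space, of \<rho> v] unfolding A_def by blast
    have "qform A v = hip v (A *v w)" by (simp add: qform_hip w)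
    also have "\<dots> = hip (A *v w) w" by (simp add: hip_adjoint A w)
    also have "\<dots> = qform A w" by (simp add: qform_hip hip_adjoint A)
    finally show ?thesis using q[OF w(1)] by (simp add: A_def)
  qed
  then have "psd A" using A by (simp add: psd_iff)
  \<comment> \<open>For \<open>y = app C X *v v\<close>, moving the adjoint writes
    \<open>hip y y\<close> as the product of a vector in the range of \<open>A\<close> with
    \<open>v\<close>; range and kernel of a Hermitian matrix are orthogonal, so
    \<open>y = 0\<close>.\<close>
  moreover have "app C X *v v = 0" if v: "A *v v = 0" for v X
  proof -
    define y where "y = app C X *v v"
    have "madj (app C X) = app C (madj X)"
      using C by (simp add: HPTP_def herm_pres_def)
    then have "hip y y = hip (app C (madj X) *v y) v"
      using hip_adjoint[of y "app C X" v] by (simp add: y_def)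
    also obtain w where "app C (madj X) *v y = A *v w"
      using pre[OF app_mult_in_out_space] by blast
    also have "hip (A *v w) v = hip w (A *v v)" by (simp add: hip_adjoint A)
    finally show ?thesis by (simp add: v hip_self y_def)
  qed
  ultimately show "\<exists>\<rho>. pdef \<rho> \<and> mtrace \<rho> = 1 \<and> psd (app C \<rho>) \<and>
      (\<forall>v. app C \<rho> *v v = 0 \<longrightarrow> (\<forall>X. app C X *v v = 0))"
    using \<rho> by (intro exI[of _ \<rho>]) (simp add: A_def)
next
  assume "\<exists>\<rho>. pdef \<rho> \<and> mtrace \<rho> = 1 \<and> psd (app C \<rho>) \<and>
      (\<forall>v. app C \<rho> *v v = 0 \<longrightarrow> (\<forall>X. app C X *v v = 0))"
  then obtain \<rho> where \<rho>: "pdef \<rho>" "mtrace \<rho> = 1" "psd (app C \<rho>)"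
    and ker: "\<And>v X. app C \<rho> *v v = 0 \<Longrightarrow> app C X *v v = 0" by blast
  let ?S = "out_space C" and ?f = "\<lambda>v. app C \<rho> *v v"
  \<comment> \<open>The difference of two points with equal image lies in \<open>out_space C\<close>
    and in the common kernel, which is orthogonal to it.\<close>
  have inj: "inj_on ?f ?S"
  proof (rule inj_onI)
    fix v w assume vw: "v \<in> ?S" "w \<in> ?S" "?f v = ?f w"
    define u where "u = v - w"
    have "app C X *v u = 0" for X
      by (rule ker) (simp add: u_def vw matrix_vector_mult_diff_distrib)
    moreover have "u \<in> ?S"
      unfolding u_def using vw subspace_out_space vec.subspace_diff by blast
    ultimately have "hip u u = 0" using hip_out_space_zero[OF _ C] by blast
    then show "v = w" by (simp add: hip_self u_def)
  qed
  \<comment> \<open>Surjectivity by dimension: an injective linear map of a finite-dimensional space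
    into itself is onto.\<close>
  have "?f ` ?S = ?S"
  proof (rule vec.subspace_dim_equal)
    have lin: "Vector_Spaces.linear (*s) (*s) ?f" by (rule matrix_vector_mul_linear_gen)
    show "vec.subspace (?f ` ?S)"
      by (rule vec.linear_subspace_image[OF lin subspace_out_space])
    show "vec.subspace ?S" by (rule subspace_out_space)
    show "?f ` ?S \<subseteq> ?S" using app_mult_in_out_space by blast
    have "vec.span ?S = ?S" by (simp add: out_space_def vec.span_span)
    with inj have "inj_on ?f (vec.span ?S)" by (simp only:)
    from vec.dim_image_eq[OF lin this] show "vec.dim ?S \<le> vec.dim (?f ` ?S)" by simp
  qed
  with inj have "bij_betw ?f ?S ?S" by (simp add: bij_betw_def)
  then show "SPR_map C"
    unfolding SPR_map_def using \<rho> C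
    by (intro exI[of _ \<rho>]) (auto simp: density_def pdef_iff psd_def HPTP_mtrace)
qed

lemma SPs_subset_SPRs: "SPs \<subseteq> SPRs"
proof
  fix C :: "complex^'m^'m^'n^'n" assume "C \<in> SPs"
  then have C: "C \<in> HPTP" "SP_map C" by (auto simp: SPs_def)
  then obtain \<rho> where \<rho>: "pdef \<rho>" "mtrace \<rho> = 1" "pdef (app C \<rho>)"
    by (auto simp: SP_map_iff)
  have "v = 0" if "app C \<rho> *v v = 0" for v
    using \<rho>(3) that unfolding pdef_iff invertible_left_inverse matrix_left_invertible_ker by blast
  then have "app C X *v v = 0" if "app C \<rho> *v v = 0" for v X
    using that by (metis matrix_vector_mult_0_right)
  then have "SPR_map C"
    unfolding SPR_map_iff[OF C(1)] using \<rho> pdef_psd by blast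
  with C show "C \<in> SPRs" by (simp add: SPRs_def)
qed

lemma SPRs_subset_SNs: "SPRs \<subseteq> SNs"
  unfolding SPRs_def SNs_def SN_map_def density_def
  using SPR_map_iff pdef_psd HPTP_mtrace by (smt (verit) Collect_mono)

lemma Ps_subset_SPRs: "Ps \<subseteq> SPRs"
proof
  fix C :: "complex^'m^'m^'n^'n" assume C: "C \<in> Ps"
  then have H: "C \<in> HPTP" by (simp add: Ps_def)
  have "SPR_map C"
    unfolding SPR_map_iff[OF H] using C Ps_kernel[OF C pdef_mix_state]
    by (intro exI[of _ mix_state])
       (simp add: Ps_def positive_map_def pdef_mix_state pdef_psd[OF pdef_mix_state])
  then show "C \<in> SPRs" using H by (simp add: SPRs_def)
qed

section \<open>Star centers\<close>

text \<open>Adding a small multiple of the identity makes a violating input positive definite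
  without losing the violation; normalizing the trace then only rescales the form.\<close>

lemma pdef_witness_of_not_positive:
  fixes C :: "complex^'m^'m^'n^'n"
  assumes C: "C \<in> HPTP" "C \<notin> Ps"
  obtains \<rho> v where "pdef \<rho>" "mtrace \<rho> = 1" "Re (qform (app C \<rho>) v) < 0"
proof -
  obtain X where X: "psd X" "\<not> psd (app C X)"
    using C by (auto simp: Ps_def positive_map_def)
  have "madj (app C X) = app C X" using HPTP_hermitian[OF C(1) psd_hermitian[OF X(1)]] .
  then obtain v where v: "Re (qform (app C X) v) < 0"
    using X(2) by (auto simp: psd_iff not_le)
  define a b where "a = Re (qform (app C X) v)" and "b = Re (qform (app C (mat 1)) v)"
  \<comment> \<open>Chosen with \<open>e * (\<bar>b\<bar> + 1) = - a / 2\<close>, so that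
    \<open>a + e * b \<le> a / 2 < 0\<close> for either sign of \<open>b\<close>.\<close>
  define e where "e = - a / (2 * (\<bar>b\<bar> + 1))"
  have e: "e > 0" using v unfolding e_def a_def by (intro divide_pos_pos) auto
  have "e * b \<le> e * (\<bar>b\<bar> + 1)" using e by (intro mult_left_mono) auto
  also have "\<dots> = - a / 2" unfolding e_def by (simp add: field_simps)
  finally have ab: "a + e * b < 0" using v by (simp add: a_def)
  define Y where "Y = e *\<^sub>R mat 1 + X"
  have Y: "pdef Y" unfolding Y_def using X(1) e by (intro pdef_add_psd pdef_scaleR pdef_mat_1)
  define r where "r = Re (mtrace Y)"
  have r: "r > 0" "mtrace Y = of_real r"
    using pdef_mtrace_pos[OF Y] psd_mtrace[OF pdef_psd[OF Y]] by (simp_all add: r_def)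
  have "Re (qform (app C Y) v) = a + e * b"
    by (simp add: Y_def app_add app_scaleR qform_add qform_scaleR a_def b_def)
  then have "Re (qform (app C ((1/r) *\<^sub>R Y)) v) < 0"
    using ab r(1) by (simp add: app_scaleR qform_scaleR divide_neg_pos)
  moreover have "pdef ((1/r) *\<^sub>R Y)" using Y r by (intro pdef_scaleR) auto
  moreover have "mtrace ((1/r) *\<^sub>R Y) = 1" using r by (simp add: mtrace_scaleR)
  ultimately show thesis using that by blast
qed

lemma not_positive_leaves_SNs:
  fixes C :: "complex^'m^'m^'n^'n"
  assumes C: "C \<in> HPTP" "C \<notin> Ps"
  obtains D where "D \<in> SPs" "\<not> closed_segment C D \<subseteq> SNs"
proof -
  obtain \<rho> v where \<rho>: "pdef \<rho>" "mtrace \<rho> = 1" and v: "Re (qform (app C \<rho>) v) < 0"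
    using pdef_witness_of_not_positive[OF C] by blast
  define A where "A = app C \<rho>"
  define s where "s = Re (qform mix_state v)"
  define a where "a = Re (qform A v)"
  have a: "a < 0" using v by (simp add: a_def A_def)
  have "psd (mix_state :: complex^'m^'m)" by (rule pdef_psd[OF pdef_mix_state])
  then have s: "s \<ge> 0" by (simp add: s_def psd_def)
  \<comment> \<open>Makes \<open>s + t * a = -1\<close>, so \<open>mix_state + t *\<^sub>R A\<close>
    has a negative form at \<open>v\<close>.\<close>
  define t where "t = (s + 1) / (- a)"
  have t: "t > 0" using a s by (simp add: t_def divide_pos_neg)
  have "t * a = - (s + 1)" using a by (simp add: t_def)
  then have sta: "s + t * a < 0" by simp
  have A: "madj A = A" "mtrace A = 1"
    unfolding A_def using C \<rho> by (auto simp: HPTP_mtrace intro: HPTP_hermitian psd_hermitian pdef_psd)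
  \<comment> \<open>At \<open>\<rho>\<close> the bracket vanishes, because
    \<open>const_map A\<close> and \<open>C\<close> both send it to \<open>A\<close>; hence
    \<open>D\<close> maps \<open>\<rho>\<close> to \<open>mix_state\<close>.\<close>
  define D where "D = const_map mix_state - t *\<^sub>R (C - const_map A)"
  have "const_map mix_state \<in> (HPTP :: (complex^'m^'m^'n^'n) set)"
    by (intro const_map_HPTP) (auto intro: psd_hermitian pdef_psd pdef_mix_state)
  moreover have "const_map A \<in> (HPTP :: (complex^'m^'m^'n^'n) set)"
    using A by (intro const_map_HPTP)
  ultimately have D: "D \<in> HPTP"
    using C(1) unfolding D_def HPTP_def trace_pres_def
    by (simp add: herm_pres_diff herm_pres_scaleR app_map_simps mtrace_diff mtrace_scaleR)
  have "app D \<rho> = mix_state"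
    by (simp add: D_def app_map_simps app_const_map \<rho> flip: A_def)
  then have "SP_map D"
    unfolding SP_map_iff using \<rho> pdef_mix_state mtrace_mix_state by metis
  with D have "D \<in> SPs" by (simp add: SPs_def)
  moreover have "\<not> closed_segment C D \<subseteq> SNs"
  proof
    assume sub: "closed_segment C D \<subseteq> SNs"
    \<comment> \<open>The weight with \<open>1 - u = u * t\<close>, for which the contributions of
      \<open>C\<close> cancel: \<open>E\<close> sends every density matrix to the same
      matrix.\<close>
    define u where "u = 1 / (1 + t)"
    have u: "0 \<le> u" "u \<le> 1" "u > 0" "1 - u = u * t"
      using t by (simp_all add: u_def field_simps)
    define E where "E = (1 - u) *\<^sub>R C + u *\<^sub>R D"
    have "E \<in> closed_segment C D" using u(1,2) unfolding E_def in_segment by blast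
    then have "E \<in> SNs" using sub by blast
    then obtain \<sigma> where \<sigma>: "density \<sigma>" "density (app E \<sigma>)"
      by (auto simp: SNs_def SN_map_def)
    have "app E \<sigma> = u *\<^sub>R (mix_state + t *\<^sub>R A)"
      using \<sigma>(1) by (simp add: E_def D_def u(4) app_map_simps app_const_map density_def algebra_simps)
    then have "Re (qform (app E \<sigma>) v) = u * (s + t * a)"
      by (simp add: qform_scaleR qform_add s_def a_def)
    also have "\<dots> < 0" using u(3) sta by (simp add: mult_pos_neg)
    finally show False using \<sigma>(2) unfolding density_def psd_def by (meson not_le)
  qed
  ultimately show thesis using that by blast
qed

text \<open>Serves all three classes at once: the test map lies in the smallest class and the
  segment to it leaves the largest one.\<close>

lemma star_center_subset_Ps:
  assumes "SPs \<subseteq> S" "S \<subseteq> SNs"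
  shows "star_center S \<subseteq> Ps"
proof
  fix C assume C: "C \<in> star_center S"
  then have "C \<in> HPTP" using assms by (auto simp: star_center_def SNs_def)
  moreover have "closed_segment C D \<subseteq> SNs" if "D \<in> SPs" for D
    using C assms that unfolding star_center_def by blast
  ultimately show "C \<in> Ps" using not_positive_leaves_SNs by metis
qed

text \<open>The witness of \<open>D\<close> works for every mixture, since a positive
  \<open>C\<close> sends it to a positive semidefinite matrix too.\<close>

lemma Ps_subset_star_center_SNs: "Ps \<subseteq> star_center SNs"
proof
  fix C :: "complex^'m^'m^'n^'n" assume C: "C \<in> Ps"
  have "(1 - u) *\<^sub>R C + u *\<^sub>R D \<in> SNs" if D: "D \<in> SNs" and u: "0 \<le> u" "u \<le> 1" for D u
  proof -
    obtain \<rho> where \<rho>: "density \<rho>" "density (app D \<rho>)"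
      using D by (auto simp: SNs_def SN_map_def)
    have H: "(1 - u) *\<^sub>R C + u *\<^sub>R D \<in> HPTP"
      using C D by (intro HPTP_segment) (auto simp: Ps_def SNs_def)
    have "psd (app C \<rho>)" using C \<rho> by (simp add: Ps_def positive_map_def density_def)
    then have "psd (app ((1 - u) *\<^sub>R C + u *\<^sub>R D) \<rho>)"
      using \<rho> u by (simp add: app_map_simps psd_add psd_scaleR density_def)
    then have "density (app ((1 - u) *\<^sub>R C + u *\<^sub>R D) \<rho>)"
      using \<rho> HPTP_mtrace[OF H] by (simp add: density_def)
    with \<rho> H show ?thesis by (auto simp: SNs_def SN_map_def)
  qed
  then show "C \<in> star_center SNs"
    using C Ps_subset_SPRs SPRs_subset_SNs by (auto simp: star_center_def in_segment)
qed

text \<open>The witness of \<open>D\<close> works again. Where the mixed form vanishes, both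
  nonnegative summands do; then \<open>Ps_kernel\<close> for \<open>C\<close> and the SPR property
  of \<open>D\<close> annihilate all outputs.\<close>

lemma Ps_subset_star_center_SPRs: "Ps \<subseteq> star_center SPRs"
proof
  fix C :: "complex^'m^'m^'n^'n" assume C: "C \<in> Ps"
  have CR: "C \<in> SPRs" using C Ps_subset_SPRs by blast
  have "(1 - u) *\<^sub>R C + u *\<^sub>R D \<in> SPRs" if D: "D \<in> SPRs" and u: "0 \<le> u" "u \<le> 1" for D u
  \<comment> \<open>Both weights must be positive to separate the summands; the endpoints are
    \<open>C\<close> and \<open>D\<close> themselves.\<close>
  proof (cases "u = 0 \<or> u = 1")
    case True
    then show ?thesis using CR D by auto
  next
    case False
    then have u: "0 < u" "u < 1" using u by auto
    define E where "E = (1 - u) *\<^sub>R C + u *\<^sub>R D"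
    have DH: "D \<in> HPTP" "SPR_map D" using D by (auto simp: SPRs_def)
    then obtain \<rho> where \<rho>: "pdef \<rho>" "mtrace \<rho> = 1" "psd (app D \<rho>)"
      and ker: "\<And>v X. app D \<rho> *v v = 0 \<Longrightarrow> app D X *v v = 0"
      using SPR_map_iff[OF DH(1)] by blast
    have H: "E \<in> HPTP"
      unfolding E_def using C DH by (intro HPTP_segment) (auto simp: Ps_def)
    have C\<rho>: "psd (app C \<rho>)" using C pdef_psd[OF \<rho>(1)] by (simp add: Ps_def positive_map_def)
    have app_E: "app E X = (1 - u) *\<^sub>R app C X + u *\<^sub>R app D X" for X
      by (simp add: E_def app_map_simps)
    have psd: "psd (app E \<rho>)"
      unfolding app_E using \<rho> C\<rho> u by (simp add: psd_add psd_scaleR)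
    have "app E X *v v = 0" if v: "app E \<rho> *v v = 0" for v X
    proof -
      have "(1 - u) * Re (qform (app C \<rho>) v) + u * Re (qform (app D \<rho>) v) = Re (qform (app E \<rho>) v)"
        by (simp add: app_E qform_add qform_scaleR)
      also have "\<dots> = 0" by (simp add: qform_hip v)
      finally have sum0: "(1 - u) * Re (qform (app C \<rho>) v) + u * Re (qform (app D \<rho>) v) = 0" .
      have nn: "Re (qform (app C \<rho>) v) \<ge> 0" "Re (qform (app D \<rho>) v) \<ge> 0"
        using C\<rho> \<rho>(3) by (simp_all add: psd_def)
      then have "(1 - u) * Re (qform (app C \<rho>) v) = 0 \<and> u * Re (qform (app D \<rho>) v) = 0"
        using sum0 u by (subst (asm) add_nonneg_eq_0_iff) auto
      then have "Re (qform (app C \<rho>) v) = 0" "Re (qform (app D \<rho>) v) = 0" using u by auto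
      then have "app C \<rho> *v v = 0" "app D \<rho> *v v = 0"
        using psd_qform_zero_kernel C\<rho> \<rho>(3) by blast+
      then have "app C X *v v = 0" "app D X *v v = 0"
        using Ps_kernel[OF C \<rho>(1)] ker by blast+
      then show ?thesis
        by (simp add: app_E matrix_vector_mult_add_rdistrib scaleR_mult_vec)
    qed
    then have "SPR_map E" unfolding SPR_map_iff[OF H] using \<rho> psd by blast
    with H show ?thesis by (simp add: SPRs_def E_def)
  qed
  then show "C \<in> star_center SPRs"
    using CR by (auto simp: star_center_def in_segment)
qed

text \<open>One positive definite output makes the common kernel trivial, so by
  \<open>Ps_kernel\<close> such a \<open>C\<close> keeps every positive definite input positive
  definite, in particular the witness of \<open>D\<close>.\<close>

lemma SPs_Ps_subset_star_center_SPs: "SPs \<inter> Ps \<subseteq> star_center SPs"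
proof
  fix C :: "complex^'m^'m^'n^'n" assume "C \<in> SPs \<inter> Ps"
  then have CS: "C \<in> SPs" and C: "C \<in> Ps" by auto
  then obtain \<rho>0 where \<rho>0: "pdef (app C \<rho>0)"
    by (auto simp: SPs_def SP_map_iff)
  have pres: "pdef (app C \<rho>)" if "pdef \<rho>" for \<rho>
  proof -
    have "v = 0" if "app C \<rho> *v v = 0" for v
      using Ps_kernel[OF C \<open>pdef \<rho>\<close> that, of \<rho>0] \<rho>0
      unfolding pdef_iff invertible_left_inverse matrix_left_invertible_ker by blast
    moreover have "psd (app C \<rho>)" using C pdef_psd[OF that] by (simp add: Ps_def positive_map_def)
    ultimately show ?thesis
      unfolding pdef_iff invertible_left_inverse matrix_left_invertible_ker by blast
  qed
  have "(1 - u) *\<^sub>R C + u *\<^sub>R D \<in> SPs" if D: "D \<in> SPs" and u: "0 \<le> u" "u \<le> 1" for D u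
  proof (cases "u = 1")
    case True
    then show ?thesis using D by auto
  next
    case False
    then have u: "0 \<le> u" "0 < 1 - u" using u by auto
    define E where "E = (1 - u) *\<^sub>R C + u *\<^sub>R D"
    have H: "E \<in> HPTP"
      unfolding E_def using C D by (intro HPTP_segment) (auto simp: Ps_def SPs_def)
    obtain \<rho> where \<rho>: "pdef \<rho>" "mtrace \<rho> = 1" "pdef (app D \<rho>)"
      using D by (auto simp: SPs_def SP_map_iff)
    have "app E \<rho> = (1 - u) *\<^sub>R app C \<rho> + u *\<^sub>R app D \<rho>"
      by (simp add: E_def app_map_simps)
    then have "pdef (app E \<rho>)"
      using pdef_add_psd[OF pdef_scaleR[OF pres[OF \<rho>(1)] u(2)] psd_scaleR[OF pdef_psd[OF \<rho>(3)] u(1)]]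
      by simp
    then have "SP_map E"
      unfolding SP_map_iff using \<rho> HPTP_mtrace[OF H] by metis
    with H show ?thesis by (simp add: SPs_def E_def)
  qed
  then show "C \<in> star_center SPs"
    using CS by (auto simp: star_center_def in_segment)
qed

text \<open>The completely depolarizing map; it lies in all three star centers and so shows
  star-shapedness.\<close>

lemma const_map_mix_state: "(const_map mix_state :: complex^'b^'b^'a^'a) \<in> SPs \<inter> Ps"
proof -
  have P: "(const_map mix_state :: complex^'b^'b^'a^'a) \<in> Ps"
    by (intro const_map_Ps pdef_psd pdef_mix_state mtrace_mix_state)
  have "SP_map (const_map mix_state :: complex^'b^'b^'a^'a)"
    unfolding SP_map_iff
    by (intro exI[of _ mix_state]) (simp add: pdef_mix_state app_const_map)
  with P show ?thesis by (simp add: SPs_def Ps_def)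
qed

lemma star_center_imp_starlike: "c \<in> star_center S \<Longrightarrow> starlike S"
  by (auto simp: star_center_def starlike_def)

lemma star_center_convex: "convex S \<Longrightarrow> star_center S = S"
  by (auto simp: star_center_def convex_contains_segment)

section \<open>Topology\<close>

lemma linear_app_map: "linear (\<lambda>C. app C X)"
  by (intro linearI) (simp_all add: app_map_simps)

lemma linear_qform: "linear (\<lambda>A. qform A v)"
  by (intro linearI) (simp_all add: qform_add qform_scaleR scaleR_conv_of_real[where 'a=complex])

lemma linear_madj: "linear madj"
  by (intro linearI) (simp_all add: madj_add madj_scaleR)

lemma linear_mtrace: "linear mtrace"
  by (intro linearI) (simp_all add: mtrace_add mtrace_scaleR scaleR_conv_of_real[where 'a=complex])

lemma linear_imp_continuous_on: "linear f \<Longrightarrow> continuous_on S f"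
  for f :: "'a::euclidean_space \<Rightarrow> 'b::real_normed_vector"
  by (simp add: linear_continuous_on linear_conv_bounded_linear)

lemmas continuous_app_map = linear_imp_continuous_on[OF linear_app_map]
lemmas continuous_madj_app =
  linear_imp_continuous_on[OF linear_compose[OF linear_app_map linear_madj, unfolded o_def]]
lemmas continuous_mtrace_app =
  linear_imp_continuous_on[OF linear_compose[OF linear_app_map linear_mtrace, unfolded o_def]]

lemma closed_psd: "closed {A. psd A}"
  unfolding psd_def
  by (intro closed_Collect_all closed_Collect_conj closed_Collect_eq closed_Collect_le
      continuous_on_Re continuous_on_Im continuous_on_const
      linear_imp_continuous_on linear_qform)

lemma closed_HPTP: "closed (HPTP :: (complex^'m^'m^'n^'n) set)"
  unfolding HPTP_def herm_pres_def trace_pres_def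
  by (intro closed_Collect_all closed_Collect_conj closed_Collect_eq continuous_on_const
      continuous_app_map continuous_madj_app continuous_mtrace_app)

lemma compact_densities: "compact {A :: complex^'n^'n. density A}"
proof (rule compact_eq_bounded_closed[THEN iffD2], rule conjI)
  show "bounded {A :: complex^'n^'n. density A}"
  proof (rule boundedI)
    fix A :: "complex^'n^'n" assume "A \<in> {A. density A}"
    then show "norm A \<le> (real CARD('n))\<^sup>2"
      using psd_norm_le_trace[of A] by (simp add: density_def)
  qed
  show "closed {A :: complex^'n^'n. density A}"
    unfolding density_def
    by (intro closed_Collect_conj closed_psd closed_Collect_eq continuous_on_const
        linear_imp_continuous_on linear_mtrace)
qed

text \<open>Joint continuity: in \<open>closed_SNs\<close> the map and its witness vary
  together.\<close>

lemma tendsto_app: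
  assumes "(f \<longlongrightarrow> C) F" "(g \<longlongrightarrow> X) F"
  shows "((\<lambda>n. app (f n) (g n)) \<longlongrightarrow> app C X) F"
proof -
  have "((\<lambda>n. app (f n) (g n) $ k $ l) \<longlongrightarrow> app C X $ k $ l) F" for k l
    unfolding app_def vec_lambda_beta by (intro tendsto_sum tendsto_mult tendsto_vec_nth assms)
  then show ?thesis by (intro vec_tendstoI)
qed

text \<open>The witnesses of a convergent sequence of maps have a convergent subsequence by
  compactness of the density matrices; its limit is a witness for the limit map.\<close>

lemma closed_SNs: "closed (SNs :: (complex^'m^'m^'n^'n) set)"
  unfolding closed_sequential_limits
proof (intro allI impI, elim conjE)
  fix f :: "nat \<Rightarrow> complex^'m^'m^'n^'n" and C
  assume f: "\<forall>n. f n \<in> SNs" and lim: "f \<longlonglongrightarrow> C"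
  have "\<forall>n. \<exists>\<rho>. density \<rho> \<and> density (app (f n) \<rho>)"
    using f by (auto simp: SNs_def SN_map_def)
  then obtain \<rho> where \<rho>: "\<And>n. density (\<rho> n)" "\<And>n. density (app (f n) (\<rho> n))" by metis
  obtain \<sigma> r where \<sigma>: "density \<sigma>" and r: "strict_mono r" "(\<rho> \<circ> r) \<longlonglongrightarrow> \<sigma>"
    using compact_densities \<rho>(1) unfolding compact_def
    by (metis (mono_tags, lifting) mem_Collect_eq)
  have "(\<lambda>n. app ((f \<circ> r) n) ((\<rho> \<circ> r) n)) \<longlonglongrightarrow> app C \<sigma>"
    by (intro tendsto_app r LIMSEQ_subseq_LIMSEQ[OF lim r(1)])
  moreover have "closed {A :: complex^'m^'m. density A}"
    using compact_densities compact_imp_closed by blast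
  ultimately have "app C \<sigma> \<in> {A. density A}"
    by (elim closed_sequentially[rotated 2]) (simp_all add: \<rho>(2))
  then have "density (app C \<sigma>)" by simp
  moreover have "C \<in> HPTP"
    using closed_sequentially[OF closed_HPTP _ lim] f by (auto simp: SNs_def)
  ultimately show "C \<in> SNs" using \<sigma> by (auto simp: SNs_def SN_map_def)
qed

text \<open>The same \<open>\<rho>\<close> stays a witness nearby: inside \<open>HPTP\<close> the
  change of its image is Hermitian, and \<open>pdef_absorbs_small\<close> applies.\<close>

lemma openin_SPs: "openin (top_of_set HPTP) (SPs :: (complex^'m^'m^'n^'n) set)"
  unfolding openin_euclidean_subtopology_iff
proof (intro conjI ballI)
  show "SPs \<subseteq> HPTP" by (auto simp: SPs_def)
  fix C :: "complex^'m^'m^'n^'n" assume C: "C \<in> SPs"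
  then have CH: "C \<in> HPTP" by (simp add: SPs_def)
  obtain \<rho> where \<rho>: "pdef \<rho>" "mtrace \<rho> = 1" "pdef (app C \<rho>)"
    using C by (auto simp: SPs_def SP_map_iff)
  obtain e where e: "e > 0" "\<And>B. madj B = B \<Longrightarrow> norm B < e \<Longrightarrow> pdef (app C \<rho> + B)"
    using pdef_absorbs_small[OF \<rho>(3)] by blast
  have "continuous_on UNIV (\<lambda>C :: complex^'m^'m^'n^'n. app C \<rho>)" by (rule continuous_app_map)
  then obtain d where d: "d > 0" "\<And>D. dist D C < d \<Longrightarrow> dist (app D \<rho>) (app C \<rho>) < e"
    unfolding continuous_on_iff using e(1) by (metis UNIV_I)
  have "D \<in> SPs" if D: "D \<in> HPTP" "dist D C < d" for D
  proof -
    have h: "madj \<rho> = \<rho>" using \<rho>(1) by (simp add: pdef_def)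
    have "pdef (app C \<rho> + (app D \<rho> - app C \<rho>))"
      using d(2)[OF D(2)] by (intro e(2))
        (simp_all add: madj_diff HPTP_hermitian[OF D(1) h] HPTP_hermitian[OF CH h] dist_norm)
    then have "SP_map D"
      unfolding SP_map_iff using \<rho> HPTP_mtrace[OF D(1), of \<rho>]
      by (intro exI[of _ \<rho>]) simp
    then show ?thesis using D by (simp add: SPs_def)
  qed
  then show "\<exists>e>0. \<forall>x'\<in>HPTP. dist x' C < e \<longrightarrow> x' \<in> SPs" using d(1) by blast
qed

section \<open>Boundedness and compactness of the positive maps\<close>

lemma Ps_app_bounded:
  fixes X :: "complex^'n^'n"
  shows "\<exists>B. \<forall>C\<in>(Ps :: (complex^'m^'m^'n^'n) set). norm (app C X) \<le> B"
proof -
  have psd: "norm (app C Y) \<le> (real CARD('m))\<^sup>2 * Re (mtrace Y)"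
    if "C \<in> Ps" "psd Y" for C :: "complex^'m^'m^'n^'n" and Y
    using psd_norm_le_trace[of "app C Y"] that
    by (simp add: Ps_def positive_map_def HPTP_mtrace)
  \<comment> \<open>A Hermitian \<open>H\<close> is a difference of two positive semidefinite
    matrices, on each of which positivity and trace preservation bound the image by a multiple of
    the input's trace.\<close>
  have herm: "\<exists>B. \<forall>C\<in>(Ps :: (complex^'m^'m^'n^'n) set). norm (app C H) \<le> B"
    if "madj H = H" for H
  proof -
    obtain c where c: "c > 0" "psd (c *\<^sub>R mat 1 + H)"
      using pdef_dominates_hermitian[OF pdef_mat_1 \<open>madj H = H\<close>] by blast
    have c1: "psd (c *\<^sub>R mat 1 :: complex^'n^'n)"
      using c(1) by (intro psd_scaleR pdef_psd pdef_mat_1) simp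
    have "norm (app C H) \<le> (real CARD('m))\<^sup>2 * Re (mtrace (c *\<^sub>R mat 1 + H))
        + (real CARD('m))\<^sup>2 * Re (mtrace (c *\<^sub>R mat 1 :: complex^'n^'n))"
      if C: "C \<in> Ps" for C :: "complex^'m^'m^'n^'n"
    proof -
      have "app C H = app C (c *\<^sub>R mat 1 + H) - app C (c *\<^sub>R mat 1)"
        by (simp add: app_add)
      then show ?thesis
        using psd[OF C c(2)] psd[OF C c1] norm_triangle_ineq4 by (smt (verit))
    qed
    then show ?thesis by blast
  qed
  obtain H K where HK: "madj H = H" "madj K = K" "X = H + cscale \<i> K"
    using hermitian_decomposition by blast
  obtain B1 B2 where B: "\<forall>C\<in>(Ps :: (complex^'m^'m^'n^'n) set). norm (app C H) \<le> B1"
    "\<forall>C\<in>(Ps :: (complex^'m^'m^'n^'n) set). norm (app C K) \<le> B2"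
    using herm HK by meson
  have "norm (app C X) \<le> B1 + B2" if "C \<in> Ps" for C :: "complex^'m^'m^'n^'n"
  proof -
    have "norm (app C X) \<le> norm (app C H) + norm (cscale \<i> (app C K))"
      by (simp add: HK(3) app_add app_cscale norm_triangle_ineq)
    also have "\<dots> \<le> B1 + B2"
      using B that norm_cscale_i_le[of "app C K"] by fastforce
    finally show ?thesis .
  qed
  then show ?thesis by blast
qed

lemma app_matrix_unit: "app C (axis i (axis j 1)) = C$i$j"
proof -
  have "(\<Sum>a\<in>UNIV. \<Sum>b\<in>UNIV. axis i (axis j 1) $a$b * C$a$b$k$l) = C$i$j$k$l" for k l
  proof -
    have "(\<Sum>b\<in>UNIV. axis i (axis j 1) $a$b * C$a$b$k$l) = (if a = i then C$i$j$k$l else 0)" for a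
    proof -
      have "(\<Sum>b\<in>UNIV. axis i (axis j 1) $a$b * C$a$b$k$l)
          = (\<Sum>b\<in>UNIV. if b = j then (if a = i then C$i$j$k$l else 0) else 0)"
        by (rule sum.cong) (auto simp: axis_def)
      then show ?thesis by simp
    qed
    then show ?thesis by simp
  qed
  then show ?thesis by (simp add: app_def vec_eq_iff)
qed

text \<open>The slices of the tensor are the images of the finitely many matrix units
  \<open>axis i (axis j 1)\<close>, so pointwise bounds suffice.\<close>

lemma bounded_Ps: "bounded (Ps :: (complex^'m^'m^'n^'n) set)"
proof -
  have "\<forall>X. \<exists>B. \<forall>C\<in>(Ps :: (complex^'m^'m^'n^'n) set). norm (app C X) \<le> B"
    using Ps_app_bounded by blast
  then obtain f where f: "\<forall>X. \<forall>C\<in>(Ps :: (complex^'m^'m^'n^'n) set). norm (app C X) \<le> f X"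
    by (rule choice[THEN exE])
  define B where "B i j = f (axis i (axis j 1))" for i j
  have B: "norm (app C (axis i (axis j 1))) \<le> B i j"
    if "C \<in> Ps" for i j and C :: "complex^'m^'m^'n^'n"
    using f that by (simp add: B_def)
  show ?thesis
  proof (rule boundedI)
    fix C :: "complex^'m^'m^'n^'n" assume C: "C \<in> Ps"
    have "norm C \<le> (\<Sum>i\<in>UNIV. norm (C$i))" by (rule norm_vec_le_sum)
    also have "\<dots> \<le> (\<Sum>i\<in>UNIV. \<Sum>j\<in>UNIV. norm (C$i$j))"
      by (intro sum_mono norm_vec_le_sum)
    also have "\<dots> \<le> (\<Sum>i\<in>UNIV. \<Sum>j\<in>UNIV. B i j)"
      using B[OF C] by (intro sum_mono) (simp add: app_matrix_unit)
    finally show "norm C \<le> (\<Sum>i\<in>UNIV. \<Sum>j\<in>UNIV. B i j)" .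
  qed
qed

lemma compact_Ps: "compact (Ps :: (complex^'m^'m^'n^'n) set)"
proof -
  have "closed {C :: complex^'m^'m^'n^'n. psd (app C X)}" for X
    using closed_vimage[OF closed_psd continuous_app_map] by (simp add: vimage_def)
  then have "closed {C :: complex^'m^'m^'n^'n. psd X \<longrightarrow> psd (app C X)}" for X
    by (cases "psd X") simp_all
  then have "closed {C :: complex^'m^'m^'n^'n. positive_map C}"
    unfolding positive_map_def by (intro closed_Collect_all)
  then have "closed (Ps :: (complex^'m^'m^'n^'n) set)"
    using closed_Int[OF closed_HPTP, of "Collect positive_map"] by (simp add: Ps_def Int_def)
  then show ?thesis using bounded_Ps compact_eq_bounded_closed by blast
qed

lemma convex_Ps: "convex Ps"
  unfolding convex_def Ps_def
  by (auto simp: HPTP_affine positive_map_def app_map_simps psd_add psd_scaleR)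

section \<open>Completely positive maps\<close>

lemma block_psd_1: "block_psd 1 (\<lambda>_ _. X) \<longleftrightarrow> psd X"
proof
  assume *: "block_psd 1 (\<lambda>_ _. X)"
  have "Im (qform X v) = 0 \<and> Re (qform X v) \<ge> 0" for v
    using *[unfolded block_psd_def, rule_format, of "\<lambda>_. v"] by (simp add: Let_def qform_def)
  then show "psd X" by (simp add: psd_def)
qed (auto simp: block_psd_def psd_def Let_def qform_def)

lemma CPs_subset_Ps: "CPs \<subseteq> Ps"
proof
  fix C :: "complex^'m^'m^'n^'n" assume C: "C \<in> CPs"
  have "psd (app C X)" if "psd X" for X
  proof -
    have "block_psd 1 (\<lambda>_ _. X)" using that by (simp only: block_psd_1)
    then have "block_psd 1 (\<lambda>_ _. app C X)" using C unfolding CPs_def cp_map_def by blast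
    then show ?thesis by (simp only: block_psd_1)
  qed
  then show "C \<in> Ps" using C by (simp add: CPs_def Ps_def positive_map_def)
qed

text \<open>For fixed blocks and vectors the block form is real linear in the map, so each instance
  is a closed condition; the premise on \<open>B\<close> does not involve the map.\<close>

lemma closed_CPs: "closed (CPs :: (complex^'m^'m^'n^'n) set)"
proof -
  have lin: "linear (\<lambda>C :: complex^'m^'m^'n^'n.
      \<Sum>a<k. \<Sum>b<k. \<Sum>i\<in>UNIV. cnj (v a $ i) * (app C (B a b) *v v b) $ i)" for k B v
    by (intro linear_compose_sum ballI linearI)
       (simp_all add: app_map_simps matrix_vector_mult_add_rdistrib scaleR_mult_vec
         algebra_simps scaleR_conv_of_real[where 'a=complex])
  have "closed {C :: complex^'m^'m^'n^'n. block_psd k (\<lambda>a b. app C (B a b))}" for k B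
    unfolding block_psd_def Let_def
    by (intro closed_Collect_all closed_Collect_conj closed_Collect_eq closed_Collect_le
        continuous_on_Re continuous_on_Im continuous_on_const linear_imp_continuous_on lin)
  then have "closed {C :: complex^'m^'m^'n^'n.
      block_psd k B \<longrightarrow> block_psd k (\<lambda>a b. app C (B a b))}" for k B
    by (cases "block_psd k B") simp_all
  then have "closed {C :: complex^'m^'m^'n^'n. cp_map C}"
    unfolding cp_map_def by (intro closed_Collect_all)
  then show ?thesis
    using closed_Int[OF closed_HPTP, of "Collect cp_map"] by (simp add: CPs_def Int_def)
qed

lemma block_psd_add:
  "block_psd k A \<Longrightarrow> block_psd k B \<Longrightarrow> block_psd k (\<lambda>a b. A a b + B a b)"
  by (simp add: block_psd_def Let_def matrix_vector_mult_add_rdistrib distrib_left sum.distrib)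

lemma block_psd_scaleR:
  "block_psd k A \<Longrightarrow> 0 \<le> r \<Longrightarrow> block_psd k (\<lambda>a b. r *\<^sub>R A a b)"
  by (simp add: block_psd_def Let_def scaleR_mult_vec mult.left_commute[of _ "of_real r"]
      flip: sum_distrib_left)

lemma convex_CPs: "convex CPs"
  unfolding convex_def CPs_def
  by (auto simp: HPTP_affine cp_map_def app_map_simps block_psd_add block_psd_scaleR)

lemma compact_CPs: "compact (CPs :: (complex^'m^'m^'n^'n) set)"
  using closed_CPs bounded_Ps CPs_subset_Ps bounded_subset compact_eq_bounded_closed by blast

section \<open>Examples\<close>

definition proj :: "'m \<Rightarrow> complex^'m^'m" where
  "proj k = (\<chi> i j. if i = k \<and> j = k then 1 else 0)"

text \<open>For \<open>k \<noteq> l\<close> this is the Pauli X matrix on two coordinates: Hermitian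
  and traceless.\<close>

definition flip_matrix :: "'m \<Rightarrow> 'm \<Rightarrow> complex^'m^'m" where
  "flip_matrix k l = (\<chi> i j. if i = k \<and> j = l \<or> i = l \<and> j = k then 1 else 0)"

text \<open>Weights for which \<open>diag_map\<close> reads off \<open>X$a$a - X$b$b\<close>, a
  functional that vanishes at \<open>mix_state\<close>.\<close>

definition sgn_diff :: "'n \<Rightarrow> 'n \<Rightarrow> 'n \<Rightarrow> real" where
  "sgn_diff a b i = (if i = a then 1 else if i = b then -1 else 0)"

lemma madj_proj: "madj (proj k) = proj k"
  by (auto simp: madj_def proj_def vec_eq_iff)

lemma mtrace_proj: "mtrace (proj k) = 1"
  by (simp add: mtrace_def proj_def)

lemma qform_proj: "qform (proj k) v = of_real ((cmod (v$k))\<^sup>2)"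
proof -
  have "(proj k *v v) $ i = (if i = k then v$k else 0)" for i
  proof -
    have "(proj k *v v) $ i = (\<Sum>j\<in>UNIV. if j = k then (if i = k then v$k else 0) else 0)"
      unfolding matrix_vector_mult_def vec_lambda_beta by (rule sum.cong) (auto simp: proj_def)
    then show ?thesis by simp
  qed
  then have "qform (proj k) v = (\<Sum>i\<in>UNIV. if i = k then cnj (v$k) * v$k else 0)"
    unfolding qform_def by (intro sum.cong) auto
  then show ?thesis by (simp add: complex_norm_square mult.commute del: of_real_power)
qed

lemma psd_proj: "psd (proj k)"
  by (simp add: psd_def qform_proj del: of_real_power)

lemma madj_flip_matrix: "madj (flip_matrix k l) = flip_matrix k l"
  by (auto simp: madj_def flip_matrix_def vec_eq_iff)

lemma mtrace_flip_matrix: "k \<noteq> l \<Longrightarrow> mtrace (flip_matrix k l) = 0"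
  by (auto simp: mtrace_def flip_matrix_def intro!: sum.neutral)

lemma app_sgn_diff_map:
  assumes "a \<noteq> b"
  shows "app (diag_map (sgn_diff a b) W) X = cscale (X$a$a - X$b$b) W"
proof -
  have "of_real (sgn_diff a b i) * X$i$i
      = (if i = a then X$i$i else 0) - (if i = b then X$i$i else 0)" for i
    using assms by (simp add: sgn_diff_def)
  then show ?thesis by (simp add: app_diag_map sum_subtractf)
qed

lemma mix_state_entry: "mix_state $i$j = (if i = j then of_real (1 / real CARD('n)) else 0)"
  for i j :: "'n::finite"
  by (simp add: mix_state_def mat_def scaleR_conv_of_real[where 'a=complex])

text \<open>Arbitrarily large multiples of the perturbation leave the image of
  \<open>mix_state\<close> unchanged, so it remains a witness.\<close>

lemma unbounded_SPs:
  fixes a b :: "'n::finite" and k l :: "'m::finite"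
  assumes ab: "a \<noteq> b" and kl: "k \<noteq> l"
  shows "\<not> bounded (SPs :: (complex^'m^'m^'n^'n) set)"
proof
  assume "bounded (SPs :: (complex^'m^'m^'n^'n) set)"
  then obtain B where B: "\<And>C. C \<in> (SPs :: (complex^'m^'m^'n^'n) set) \<Longrightarrow> norm C \<le> B"
    unfolding bounded_iff by blast
  define t where "t = \<bar>B\<bar> + 1"
  define C :: "complex^'m^'m^'n^'n" where
    "C = const_map mix_state + t *\<^sub>R diag_map (sgn_diff a b) (flip_matrix k l)"
  have "C \<in> HPTP"
    unfolding C_def using const_map_mix_state
    by (intro HPTP_add_traceless madj_flip_matrix mtrace_flip_matrix kl) (auto simp: Ps_def)
  moreover have "app C mix_state = mix_state"
    by (simp add: C_def app_map_simps app_const_map app_sgn_diff_map[OF ab] mix_state_entry)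
  then have "SP_map C"
    unfolding SP_map_iff using pdef_mix_state mtrace_mix_state by metis
  ultimately have "norm C \<le> B" using B by (simp add: SPs_def)
  moreover have "C$a$a$k$l = of_real t"
    using kl by (simp add: C_def const_map_def diag_map_def sgn_diff_def flip_matrix_def
        mix_state_entry scaleR_conv_of_real[where 'a=complex])
  then have "norm (C$a$a$k$l) = t" by (simp add: t_def)
  moreover have "norm (C$a$a$k$l) \<le> norm C"
    by (meson Finite_Cartesian_Product.norm_nth_le order_trans)
  ultimately show False by (simp add: t_def)
qed

text \<open>The constant map onto the pure state \<open>proj k\<close> is positive, but moving
  weight \<open>t\<close> from \<open>l\<close> to \<open>k\<close> puts \<open>- t\<close> on the
  diagonal of every image of a density matrix, which excludes even SN.\<close>

lemma not_openin_SPRs: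
  fixes k l :: "'m::finite"
  assumes kl: "k \<noteq> l"
  shows "\<not> openin (top_of_set HPTP) (SPRs :: (complex^'m^'m^'n^'n) set)"
proof
  assume op: "openin (top_of_set HPTP) (SPRs :: (complex^'m^'m^'n^'n) set)"
  define C :: "complex^'m^'m^'n^'n" where "C = const_map (proj k)"
  define D :: "complex^'m^'m^'n^'n" where "D = const_map (proj k - proj l)"
  have CP: "C \<in> Ps" unfolding C_def by (intro const_map_Ps psd_proj mtrace_proj)
  then have "C \<in> SPRs" using Ps_subset_SPRs by blast
  then obtain e where e: "e > 0" "\<And>E. E \<in> HPTP \<Longrightarrow> dist E C < e \<Longrightarrow> E \<in> SPRs"
    using op unfolding openin_euclidean_subtopology_iff by blast
  define t where "t = e / (norm D + 1)"
  have t: "t > 0" using e(1) by (simp add: t_def add_nonneg_pos)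
  have "t * norm D < t * (norm D + 1)" using t by simp
  also have "\<dots> = e" unfolding t_def using norm_ge_zero[of D] by (simp add: add_nonneg_eq_0_iff)
  finally have "dist (C + t *\<^sub>R D) C < e" using t by (simp add: dist_norm)
  moreover have "C + t *\<^sub>R D \<in> HPTP"
    unfolding D_def const_map_def using CP
    by (intro HPTP_add_traceless) (auto simp: Ps_def madj_diff madj_proj mtrace_diff mtrace_proj)
  ultimately have "C + t *\<^sub>R D \<in> SNs" using e(2) SPRs_subset_SNs by blast
  then obtain \<rho> where \<rho>: "mtrace \<rho> = 1" "psd (app (C + t *\<^sub>R D) \<rho>)"
    by (auto simp: SNs_def SN_map_def density_def)
  have "Re (app (C + t *\<^sub>R D) \<rho> $l$l) = - t"
    using kl by (simp add: C_def D_def app_map_simps app_const_map \<rho>) (simp add: proj_def)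
  then show False using psd_diag_nonneg[OF \<rho>(2), of l] t by simp
qed

text \<open>The limit \<open>C\<close> sends \<open>mix_state\<close> to \<open>proj k\<close>, but
  the \<open>l\<close>-th diagonal entry of every output is zero. A witness would thus have
  \<open>axis l 1\<close> in its image's kernel, and SPR would make all outputs annihilate it; the
  flip term at the matrix unit for \<open>a\<close> does not.\<close>

lemma not_closedin_SPRs:
  fixes a b :: "'n::finite" and k l :: "'m::finite"
  assumes ab: "a \<noteq> b" and kl: "k \<noteq> l"
  shows "\<not> closedin (top_of_set HPTP) (SPRs :: (complex^'m^'m^'n^'n) set)"
proof
  assume "closedin (top_of_set HPTP) (SPRs :: (complex^'m^'m^'n^'n) set)"
  then have cl: "closed (SPRs :: (complex^'m^'m^'n^'n) set)"
    using closedin_closed_trans closed_HPTP by blast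
  define C :: "complex^'m^'m^'n^'n" where
    "C = const_map (proj k) + 1 *\<^sub>R diag_map (sgn_diff a b) (flip_matrix k l)"
  have CH: "C \<in> HPTP"
    unfolding C_def
    by (intro HPTP_add_traceless madj_flip_matrix mtrace_flip_matrix kl const_map_HPTP
        madj_proj mtrace_proj)
  have app_C: "app C X = cscale (mtrace X) (proj k) + cscale (X$a$a - X$b$b) (flip_matrix k l)" for X
    by (simp add: C_def app_map_simps app_const_map app_sgn_diff_map[OF ab])
  \<comment> \<open>At \<open>mix_state\<close> the image is a convex combination of
    \<open>mix_state\<close> and \<open>proj k\<close> with positive weight on the former, hence
    positive definite; \<open>Suc n\<close> keeps that weight in \<open>(0, 1]\<close>.\<close>
  define f where "f n = (1 - inverse (real (Suc n))) *\<^sub>R C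
      + inverse (real (Suc n)) *\<^sub>R const_map mix_state" for n
  have "f n \<in> SPRs" for n
  proof -
    have H: "f n \<in> HPTP"
      unfolding f_def using CH const_map_mix_state by (intro HPTP_segment) (auto simp: Ps_def)
    have "app (f n) mix_state = inverse (real (Suc n)) *\<^sub>R mix_state
        + (1 - inverse (real (Suc n))) *\<^sub>R proj k"
      by (simp add: f_def app_map_simps app_const_map app_C mix_state_entry)
    moreover have "pdef (inverse (real (Suc n)) *\<^sub>R mix_state
        + (1 - inverse (real (Suc n))) *\<^sub>R proj k)"
      by (intro pdef_add_psd pdef_scaleR psd_scaleR pdef_mix_state psd_proj)
         (simp_all add: field_simps)
    ultimately have "SP_map (f n)"
      unfolding SP_map_iff using HPTP_mtrace[OF H, of mix_state]
      by (intro exI[of _ mix_state]) (simp add: pdef_mix_state del: of_nat_Suc)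
    then have "f n \<in> SPs" using H by (simp add: SPs_def)
    then show ?thesis using SPs_subset_SPRs by blast
  qed
  moreover have "f \<longlonglongrightarrow> (1 - 0) *\<^sub>R C + 0 *\<^sub>R const_map mix_state"
    unfolding f_def by (intro tendsto_intros LIMSEQ_inverse_real_of_nat)
  ultimately have "C \<in> SPRs"
    using closed_sequentially[OF cl, of f C] by simp
  then obtain \<rho> where psd: "psd (app C \<rho>)"
    and ker: "\<And>v X. app C \<rho> *v v = 0 \<Longrightarrow> app C X *v v = 0"
    using SPR_map_iff[OF CH] by (auto simp: SPRs_def)
  have "qform (app C \<rho>) (axis l 1) = 0"
    using kl by (simp add: qform_axis app_C cscale_def proj_def flip_matrix_def)
  then have "app C (axis a (axis a 1)) *v axis l 1 = 0"
    using psd_qform_zero_kernel[OF psd] ker by simp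
  then have "app C (axis a (axis a 1)) $k$l = 0"
    by (metis matrix_vector_mult_axis zero_index)
  then show False
    using ab kl by (simp add: app_C cscale_def proj_def flip_matrix_def axis_def)
qed

theorem theorem3:
  assumes "CARD('n::finite) > 1" and "CARD('m::finite) > 1"
  shows
   "(openin (top_of_set (HPTP :: (complex^'m^'m^'n^'n) set)) SPs \<and>
     \<not> bounded (SPs :: (complex^'m^'m^'n^'n) set) \<and> \<not> convex (SPs :: (complex^'m^'m^'n^'n) set) \<and>
     starlike (SPs :: (complex^'m^'m^'n^'n) set) \<and>
     star_center (SPs :: (complex^'m^'m^'n^'n) set) = SPs \<inter> Ps)
  \<and> (closedin (top_of_set (HPTP :: (complex^'m^'m^'n^'n) set)) SNs \<and>
     \<not> bounded (SNs :: (complex^'m^'m^'n^'n) set) \<and> \<not> convex (SNs :: (complex^'m^'m^'n^'n) set) \<and>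
     starlike (SNs :: (complex^'m^'m^'n^'n) set) \<and>
     star_center (SNs :: (complex^'m^'m^'n^'n) set) = Ps)
  \<and> (\<not> bounded (SPRs :: (complex^'m^'m^'n^'n) set) \<and>
     \<not> openin (top_of_set (HPTP :: (complex^'m^'m^'n^'n) set)) SPRs \<and>
     \<not> closedin (top_of_set (HPTP :: (complex^'m^'m^'n^'n) set)) SPRs \<and>
     \<not> convex (SPRs :: (complex^'m^'m^'n^'n) set) \<and>
     starlike (SPRs :: (complex^'m^'m^'n^'n) set) \<and>
     star_center (SPRs :: (complex^'m^'m^'n^'n) set) = Ps)
  \<and> (compact (Ps :: (complex^'m^'m^'n^'n) set) \<and> convex (Ps :: (complex^'m^'m^'n^'n) set))
  \<and> (compact (CPs :: (complex^'m^'m^'n^'n) set) \<and> convex (CPs :: (complex^'m^'m^'n^'n) set))"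
proof -
  let ?SP = "SPs :: (complex^'m^'m^'n^'n) set" and ?SN = "SNs :: (complex^'m^'m^'n^'n) set"
    and ?SPR = "SPRs :: (complex^'m^'m^'n^'n) set" and ?P = "Ps :: (complex^'m^'m^'n^'n) set"
  obtain a b :: 'n where ab: "a \<noteq> b"
    using assms(1) card_le_Suc0_iff_eq[of "UNIV :: 'n set"] by auto
  obtain k l :: 'm where kl: "k \<noteq> l"
    using assms(2) card_le_Suc0_iff_eq[of "UNIV :: 'm set"] by auto
  note sub = SPs_subset_SPRs SPRs_subset_SNs
  have SP_SN: "?SP \<subseteq> ?SN" using sub by blast
  have unbdd: "\<not> bounded S" if "?SP \<subseteq> S" for S
    using unbounded_SPs[OF ab kl] bounded_subset that by blast
  \<comment> \<open>A convex set equals its star center, here a subset of the bounded set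
    \<open>Ps\<close>, contradicting \<open>unbdd\<close>.\<close>
  have nonconvex: "\<not> convex S" if "?SP \<subseteq> S" "S \<subseteq> ?SN" for S
    using star_center_subset_Ps[OF that] star_center_convex unbdd[OF that(1)]
      bounded_Ps bounded_subset by metis
  have SP: "star_center ?SP = ?SP \<inter> ?P"
    using star_center_subset_Ps[OF order_refl SP_SN] SPs_Ps_subset_star_center_SPs
    by (auto simp: star_center_def)
  have SN: "star_center ?SN = ?P"
    using star_center_subset_Ps[OF SP_SN order_refl] Ps_subset_star_center_SNs by blast
  have SPR: "star_center ?SPR = ?P"
    using star_center_subset_Ps[OF sub] Ps_subset_star_center_SPRs by blast
  have star: "starlike ?SP" "starlike ?SN" "starlike ?SPR"
    by (rule star_center_imp_starlike[of "const_map mix_state"],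
        use const_map_mix_state in \<open>auto simp: SP SN SPR\<close>)+
  have closed: "closedin (top_of_set HPTP) ?SN"
    by (rule closed_subset[OF _ closed_SNs]) (auto simp: SNs_def)
  show ?thesis
    using openin_SPs unbdd[OF order_refl] nonconvex[OF order_refl SP_SN] star SP closed
      unbdd[OF SP_SN] nonconvex[OF SP_SN order_refl] SN unbdd[OF sub(1)]
      not_openin_SPRs[OF kl] not_closedin_SPRs[OF ab kl] nonconvex[OF sub] SPR
      compact_Ps convex_Ps compact_CPs convex_CPs
    by blast
qed

end
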